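(* Let $\mathbb{G}$ be a connected (oriented) ribbon graph with a fixed total order on its edges. Then the Bollobás--Riordan--Tutte polynomial $C(\mathbb{G})\in\mathbb{Z}[X,Y,Z]$ satisfies $$ C(\mathbb{G})=\sum_{\mathbb{Q}} Y^{n(\mathcal{D}(\mathbb{Q}))}\;Z^{g(\mathcal{D}(\mathbb{Q}))}\;(1+Y)^{|\mathcal{E}(\mathbb{Q})|}\;T_{G_{\mathbb{Q}}}(X,1+YZ), $$ where the sum is over all quasi-trees $\mathbb{Q}$ of $\mathbb{G}$.
   Context: Ribbon graphs. An (oriented) ribbon graph $\mathbb{G}$ is a multigraph (loops and multiple edges allowed) embedded in a closed oriented surface $S(\mathbb{G})$ so that the complement is a disjoint union of open discs (faces). Combinatorially it is given by permutations $(\sigma_0,\sigma_1,\sigma_2)$ of the set $\{1,\dots,2n\}$ of half-edges, with $\sigma_1$ a fixed-point-free involution and $\sigma_0\sigma_1\sigma_2=1$ (composition right to left); the orbits of $\sigma_0,\sigma_1,\sigma_2$ are the vertices, edges and faces. $\mathbb{G}$ is connected iff the underlying graph is connected. (A single vertex with no edges is also a ribbon graph, with genus $0$ and one face.) Spanning subgraphs. A spanning subgraph $\mathbb{H}\subseteq\mathbb{G}$ has all vertices of $\mathbb{G}$ and some subset of its edges. Take a regular neighborhood of $\mathbb{H}$ in $S(\mathbb{G})$ (a disc at each vertex, a band along each edge of $\mathbb{H}$), and let $\gamma_{\mathbb{H}}$ be its boundary. Let $v(\mathbb{H}),e(\mathbb{H}),k(\mathbb{H})$ be the numbers of vertices,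 edges and connected components, $f(\mathbb{H})$ the number of components of $\gamma_{\mathbb{H}}$ (faces of $\mathbb{H}$), $n(\mathbb{H})=e(\mathbb{H})-v(\mathbb{H})+k(\mathbb{H})$ the nullity, and $g(\mathbb{H})$ the genus, given by $2g(\mathbb{H})=k(\mathbb{H})+n(\mathbb{H})-f(\mathbb{H})$. Combinatorially, $f(\mathbb{H})$ is the number of isolated vertices of $\mathbb{H}$ plus the number of cycles of $\sigma_0'\sigma_1'$, where $\sigma_0'$ (resp. $\sigma_1'$) is the permutation of the half-edges of $\mathbb{H}$ obtained from $\sigma_0$ (resp. $\sigma_1$) by deleting from its cycles all half-edges not in $\mathbb{H}$. Quasi-trees. A quasi-tree $\mathbb{Q}$ of $\mathbb{G}$ is a connected spanning subgraph with $f(\mathbb{Q})=1$. The polynomial. The Bollobás--Riordan--Tutte polynomial is $$C(\mathbb{G})=\sum_{\mathbb{H}}(X-1)^{k(\mathbb{H})-k(\mathbb{G})}\,Y^{n(\mathbb{H})}\,Z^{g(\mathbb{H})},$$ summed over all spanning subgraphs $\mathbb{H}$ of $\mathbb{G}$. (Equivalently, it is determined by multiplicativity on disjoint unions, $C(\mathbb{G})=C(\mathbb{G}-e)+C(\mathbb{G}/e)$ if $e$ is neither a bridge nor a loop, $C(\mathbb{G})=X\,C(\mathbb{G}/e)$ if $e$ is a bridge, and $C(\mathbb{G})=\sum_{\mathbb{H}}Y^{n(\mathbb{H})}Z^{g(\mathbb{H})}$ if $\mathbb{G}$ has one vertex.) Activities. For a quasi-tree $\mathbb{Q}$, the simple closed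 curve $\gamma_{\mathbb{Q}}$ determines an ordered chord diagram $C_{\mathbb{Q}}$: a circle marked with the half-edges $1,\dots,2n$ in the cyclic order in which they are met along $\gamma_{\mathbb{Q}}$, with chords joining $i$ and $\sigma_1(i)$ (one chord for each edge of $\mathbb{G}$). Explicitly, the half-edge following $i$ is $\sigma_0(i)$ if $i$ does not belong to an edge of $\mathbb{Q}$, and $\sigma_2^{-1}(i)=\sigma_0(\sigma_1(i))$ if it does (this is a single $2n$-cycle). Two chords intersect if their endpoints alternate on the circle. The chords inherit the total order of the edges. An edge is live with respect to $\mathbb{Q}$ if its chord does not intersect any lower-ordered chord, and dead otherwise; it is internal if it is in $\mathbb{Q}$, external otherwise. Let $\mathcal{D}(\mathbb{Q})$ be the spanning subgraph of $\mathbb{G}$ whose edges are the internally dead edges, $\mathcal{I}(\mathbb{Q})$ the set of internally live edges, and $\mathcal{E}(\mathbb{Q})$ the set of externally live edges. Let $G_{\mathbb{Q}}$ be the multigraph whose vertices are the connected components of $\mathcal{D}(\mathbb{Q})$ and whose edges are the edges in $\mathcal{I}(\mathbb{Q})$ (each joining the components containing its endpoints). $T_G(x,y)=\sum_{W}(x-1)^{k(W)-k(G)}(y-1)^{n(W)}$ (sum over spanning subgraphs $W$ of the graph $G$) is the Tutte polynomial. *)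

theory Defs
  imports "HOL-Combinatorics.Orbits" "HOL-Computational_Algebra.Polynomial"
begin

section \<open>Multigraphs and the Tutte polynomial\<close>

text \<open>
  The endpoints of an edge form a set of one (loop) or two vertices. A spanning subgraph is
  represented by its set of edges.
\<close>

record ('v, 'e) multigraph =
  mverts :: "'v set"
  medges :: "'e set"
  mends :: "'e \<Rightarrow> 'v set"

definition mcomponents :: "('v, 'e) multigraph \<Rightarrow> 'e set \<Rightarrow> 'v set set" where
  "mcomponents G W = mverts G // {(u, v). \<exists>e\<in>W. u \<in> mends G e \<and> v \<in> mends G e}\<^sup>*"

definition mk :: "('v, 'e) multigraph \<Rightarrow> 'e set \<Rightarrow> nat" where
  "mk G W = card (mcomponents G W)"

definition mnullity :: "('v, 'e) multigraph \<Rightarrow> 'e set \<Rightarrow> nat" where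
  "mnullity G W = card W + mk G W - card (mverts G)"

definition tutte :: "('v, 'e) multigraph \<Rightarrow> 'a::comm_ring_1 \<Rightarrow> 'a \<Rightarrow> 'a" where
  "tutte G x y =
     (\<Sum>W\<in>Pow (medges G). (x - 1) ^ (mk G W - mk G (medges G)) * (y - 1) ^ mnullity G W)"

section \<open>Ribbon graphs\<close>

text \<open>
  Permutations of the half-edges do not record vertices without half-edges, so their number is
  kept as a separate component.
\<close>

record ribbon_graph =
  nedges :: nat
  nisolated :: nat
  sigma0 :: "nat \<Rightarrow> nat"
  sigma1 :: "nat \<Rightarrow> nat"
  sigma2 :: "nat \<Rightarrow> nat"

definition half_edges :: "ribbon_graph \<Rightarrow> nat set" where
  "half_edges G = {1..2 * nedges G}"

definition is_ribbon_graph :: "ribbon_graph \<Rightarrow> bool" where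
  "is_ribbon_graph G \<longleftrightarrow>
     sigma0 G permutes half_edges G \<and>
     sigma1 G permutes half_edges G \<and>
     sigma2 G permutes half_edges G \<and>
     (\<forall>i\<in>half_edges G. sigma1 G i \<noteq> i \<and> sigma1 G (sigma1 G i) = i) \<and>
     sigma0 G \<circ> sigma1 G \<circ> sigma2 G = id"

definition verts :: "ribbon_graph \<Rightarrow> (nat set + nat) set" where
  "verts G = (\<lambda>i. Inl (orbit (sigma0 G) i)) ` half_edges G \<union> Inr ` {..<nisolated G}"

definition edges :: "ribbon_graph \<Rightarrow> nat set set" where
  "edges G = orbit (sigma1 G) ` half_edges G"

definition ends :: "ribbon_graph \<Rightarrow> nat set \<Rightarrow> (nat set + nat) set" where
  "ends G e = (\<lambda>i. Inl (orbit (sigma0 G) i)) ` e"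

definition underlying :: "ribbon_graph \<Rightarrow> (nat set + nat, nat set) multigraph" where
  "underlying G = \<lparr>mverts = verts G, medges = edges G, mends = ends G\<rparr>"

text \<open>
  A spanning subgraph is represented by its set of edges \<open>H \<subseteq> edges G\<close>; its half-edges are then
  the elements of \<open>\<Union>H\<close>.
\<close>

definition k_rg :: "ribbon_graph \<Rightarrow> nat set set \<Rightarrow> nat" where
  "k_rg G H = mk (underlying G) H"

definition n_rg :: "ribbon_graph \<Rightarrow> nat set set \<Rightarrow> nat" where
  "n_rg G H = mnullity (underlying G) H"

text \<open>Deleting from the cycles of a permutation all elements outside a set \<open>S\<close>: the first-return map.\<close>

definition delete_outside :: "('a \<Rightarrow> 'a) \<Rightarrow> 'a set \<Rightarrow> 'a \<Rightarrow> 'a" where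
  "delete_outside p S x = (if x \<in> S then (p ^^ (LEAST m. 0 < m \<and> (p ^^ m) x \<in> S)) x else x)"

definition f_rg :: "ribbon_graph \<Rightarrow> nat set set \<Rightarrow> nat" where
  "f_rg G H =
     card {v \<in> verts G. \<forall>e\<in>H. v \<notin> ends G e} +
     card (orbit (delete_outside (sigma0 G) (\<Union>H) \<circ> delete_outside (sigma1 G) (\<Union>H)) ` \<Union>H)"

text \<open>
  By Euler's formula \<open>k + n - f\<close> is even and nonnegative, so neither the subtraction nor the
  division truncates.
\<close>

definition g_rg :: "ribbon_graph \<Rightarrow> nat set set \<Rightarrow> nat" where
  "g_rg G H = (k_rg G H + n_rg G H - f_rg G H) div 2"

definition connected_rg :: "ribbon_graph \<Rightarrow> bool" where
  "connected_rg G \<longleftrightarrow> k_rg G (edges G) = 1"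

definition quasi_trees :: "ribbon_graph \<Rightarrow> nat set set set" where
  "quasi_trees G = {Q. Q \<subseteq> edges G \<and> k_rg G Q = 1 \<and> f_rg G Q = 1}"

section \<open>The Bollobas-Riordan-Tutte polynomial\<close>

text \<open>The ring of polynomials in X, Y, Z with integer coefficients, with Z the outermost variable.\<close>

definition varX :: "int poly poly poly" where "varX = [:[:[:0, 1:]:]:]"
definition varY :: "int poly poly poly" where "varY = [:[:0, 1:]:]"
definition varZ :: "int poly poly poly" where "varZ = [:0, 1:]"

definition brt_poly :: "ribbon_graph \<Rightarrow> int poly poly poly" where
  "brt_poly G =
     (\<Sum>H\<in>Pow (edges G).
        (varX - 1) ^ (k_rg G H - k_rg G (edges G)) * varY ^ n_rg G H * varZ ^ g_rg G H)"

section \<open>Activities\<close>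

text \<open>The successor of a half-edge along the boundary curve of \<open>Q\<close>.\<close>

definition curve_next :: "ribbon_graph \<Rightarrow> nat set set \<Rightarrow> nat \<Rightarrow> nat" where
  "curve_next G Q i = (if i \<in> \<Union>Q then sigma0 G (sigma1 G i) else sigma0 G i)"

text \<open>
  Chords on a circle whose cyclic order is given by the successor map \<open>p\<close>: travelling from the
  endpoint \<open>a\<close> of the first chord, one meets an endpoint of the second chord, then \<open>b\<close>, and then the
  other endpoint of the second chord. For distinct (hence disjoint) chords, \<open>c \<noteq> a\<close> holds.
\<close>

definition chords_intersect :: "('a \<Rightarrow> 'a) \<Rightarrow> 'a set \<Rightarrow> 'a set \<Rightarrow> bool" where
  "chords_intersect p s t \<longleftrightarrow>
     (\<exists>a b c d. s = {a, b} \<and> t = {c, d} \<and>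
        funpow_dist p a c < funpow_dist p a b \<and> funpow_dist p a b < funpow_dist p a d)"

text \<open>The order on the edges is a reflexive linear order \<open>r\<close>, with \<open>(e', e) \<in> r\<close> meaning \<open>e' \<le> e\<close>.\<close>

definition live :: "ribbon_graph \<Rightarrow> nat set rel \<Rightarrow> nat set set \<Rightarrow> nat set \<Rightarrow> bool" where
  "live G r Q e \<longleftrightarrow>
     \<not> (\<exists>e'\<in>edges G. (e', e) \<in> r \<and> e' \<noteq> e \<and> chords_intersect (curve_next G Q) e e')"

definition internally_dead :: "ribbon_graph \<Rightarrow> nat set rel \<Rightarrow> nat set set \<Rightarrow> nat set set" where
  "internally_dead G r Q = {e \<in> Q. \<not> live G r Q e}"

definition internally_live :: "ribbon_graph \<Rightarrow> nat set rel \<Rightarrow> nat set set \<Rightarrow> nat set set" where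
  "internally_live G r Q = {e \<in> Q. live G r Q e}"

definition externally_live :: "ribbon_graph \<Rightarrow> nat set rel \<Rightarrow> nat set set \<Rightarrow> nat set set" where
  "externally_live G r Q = {e \<in> edges G - Q. live G r Q e}"

definition quotient_graph ::
  "ribbon_graph \<Rightarrow> nat set rel \<Rightarrow> nat set set \<Rightarrow> ((nat set + nat) set, nat set) multigraph" where
  "quotient_graph G r Q =
     (let K = mcomponents (underlying G) (internally_dead G r Q)
      in \<lparr>mverts = K, medges = internally_live G r Q, mends = (\<lambda>e. {c \<in> K. c \<inter> ends G e \<noteq> {}})\<rparr>)"

end

theory Submission
  imports Defs
begin

text \<open>
  Toggling an edge \<open>{a, b}\<close> of a spanning subgraph \<open>H\<close> multiplies its boundary permutation by the
  transposition of \<open>a\<close> and \<open>b\<close>, which merges two boundary curves if \<open>a\<close> and \<open>b\<close> lie on different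
  ones. Applied to a quasi-tree \<open>Q\<close>, this shows that toggling \<open>m\<close> pairwise noncrossing chords yields
  \<open>m + 1\<close> curves, that toggling two crossing chords yields a quasi-tree again, and that no quasi-tree
  arises by toggling a chord together with chords that do not cross it. Hence an edge \<open>e\<close> is live
  for \<open>Q\<close> iff it is forced: every quasi-tree that agrees with \<open>Q\<close> on the edges above \<open>e\<close> also
  agrees with \<open>Q\<close> at \<open>e\<close>. It follows that every \<open>H\<close> agrees with exactly one quasi-tree off its
  live edges, that is, \<open>H = D \<union> S \<union> T\<close> with \<open>D\<close> internally dead, \<open>S\<close> internally live and
  \<open>T\<close> externally live. Finally \<open>f(H) = 1 + |I - S| + |T|\<close>, where \<open>I\<close> is the set of all internally
  live edges; so each edge of \<open>T\<close> adds a face and thus connects nothing new, and \<open>k\<close>, \<open>n\<close> and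
  \<open>g\<close> split as the formula demands.
\<close>

section \<open>Orbits of permutations\<close>

definition num_orbits :: "('a \<Rightarrow> 'a) \<Rightarrow> 'a set \<Rightarrow> nat" where
  "num_orbits f S = card (orbit f ` S)"

lemma orbit_eqI_permutation:
  assumes "permutation f" "y \<in> orbit f x"
  shows "orbit f y = orbit f x"
  using orbit_cyclic_eq3[OF cyclic_on_orbit'[OF assms(1)] assms(2)] .

lemma orbit_eq_iff:
  assumes "permutation f"
  shows "orbit f x = orbit f y \<longleftrightarrow> x \<in> orbit f y"
  using assms orbit_eqI_permutation permutation_self_in_orbit by metis

lemma num_orbits_eq_1:
  assumes "permutation f" "finite S" "num_orbits f S = 1" "x \<in> S" "y \<in> S"
  shows "y \<in> orbit f x"
proof -
  obtain O' where "orbit f ` S = {O'}"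
    using assms(3) unfolding num_orbits_def by (auto simp: card_1_singleton_iff)
  then have "orbit f x = orbit f y" using assms(4,5) by blast
  then show ?thesis using permutation_self_in_orbit[OF assms(1)] by auto
qed

section \<open>Effect of a transposition on the cycles of a permutation\<close>

lemma orbit_transpose_other:
  assumes "permutation q" "a \<notin> orbit q x" "b \<notin> orbit q x"
  shows "orbit (q \<circ> transpose a b) x = orbit q x"
  by (rule orbit_cong[OF permutation_self_in_orbit[OF assms(1)]])
     (use assms in \<open>auto simp: transpose_def\<close>)

text \<open>The new map sends \<open>a\<close> to \<open>q b\<close> and then follows
  \<open>q\<close> along the cycle of \<open>b\<close>, which avoids \<open>a\<close>.\<close>

lemma orbit_transpose_merge_subset:
  assumes "b \<notin> orbit q a" "a \<notin> orbit q b"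
  shows "orbit q b \<subseteq> orbit (q \<circ> transpose a b) a"
proof
  have start: "q b \<in> orbit (q \<circ> transpose a b) a"
    using orbit.base[of "q \<circ> transpose a b" a] unfolding o_apply transpose_apply_first .
  fix z assume "z \<in> orbit q b"
  then show "z \<in> orbit (q \<circ> transpose a b) a"
  proof induction
    case base
    show ?case by (rule start)
  next
    case (step z)
    show ?case
    proof (cases "z = b")
      case True
      then show ?thesis using start by metis
    next
      case False
      with step assms have "(q \<circ> transpose a b) z = q z" by (auto simp: transpose_def)
      then show ?thesis using orbit.step[OF step.IH] by metis
    qed
  qed
qed

lemma orbit_transpose_merge:
  assumes q: "permutation q" and b: "b \<notin> orbit q a"
  shows "orbit (q \<circ> transpose a b) a = orbit q a \<union> orbit q b"
proof -
  let ?q = "q \<circ> transpose a b"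
  have a: "a \<notin> orbit q b" using b orbit_eq_iff[OF q] by metis
  have self: "a \<in> orbit q a" "b \<in> orbit q b"
    using permutation_self_in_orbit[OF q] by auto
  have 1: "orbit q b \<subseteq> orbit ?q a" by (rule orbit_transpose_merge_subset[OF b a])
  have "orbit q a \<subseteq> orbit ?q b"
    using orbit_transpose_merge_subset[OF a b] unfolding transpose_commute[of b a] .
  also have "\<dots> \<subseteq> orbit ?q a" using 1 self(2) by (meson orbit_trans subsetD subsetI)
  finally have "orbit q a \<subseteq> orbit ?q a" .
  moreover have "orbit ?q a \<subseteq> orbit q a \<union> orbit q b"
  proof
    fix z assume "z \<in> orbit ?q a"
    then show "z \<in> orbit q a \<union> orbit q b"
      by induction (auto intro: orbit.intros simp: transpose_def)
  qed
  ultimately show ?thesis using 1 by blast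
qed

text \<open>Cycles avoiding \<open>a\<close> and \<open>b\<close> survive unchanged. A transposition
  is an involution, so one inclusion, applied both to \<open>q\<close> and to the product, gives
  equality.\<close>

lemma orbits_transpose_avoiding:
  assumes q: "permutation q"
  shows "{P \<in> orbit (q \<circ> transpose a b) ` S. a \<notin> P \<and> b \<notin> P} = {P \<in> orbit q ` S. a \<notin> P \<and> b \<notin> P}"
proof -
  have *: "{P \<in> orbit q ` S. a \<notin> P \<and> b \<notin> P} \<subseteq> {P \<in> orbit (q \<circ> transpose a b) ` S. a \<notin> P \<and> b \<notin> P}"
    if "permutation q" for q
  proof
    fix P assume "P \<in> {P \<in> orbit q ` S. a \<notin> P \<and> b \<notin> P}"
    then obtain x where "x \<in> S" "P = orbit q x" "a \<notin> P" "b \<notin> P" by blast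
    then show "P \<in> {P \<in> orbit (q \<circ> transpose a b) ` S. a \<notin> P \<and> b \<notin> P}"
      using orbit_transpose_other[OF that, of a x b] by blast
  qed
  have "permutation (q \<circ> transpose a b)"
    using q by (simp add: permutation_compose permutation_swap_id)
  from *[OF this] *[OF q] show ?thesis by (simp add: comp_assoc)
qed

lemma orbits_split:
  assumes "permutation q" "a \<in> S" "b \<in> S"
  shows "orbit q ` S = insert (orbit q a) (insert (orbit q b) {P \<in> orbit q ` S. a \<notin> P \<and> b \<notin> P})"
proof -
  have "orbit q x \<in> insert (orbit q a) (insert (orbit q b) {P \<in> orbit q ` S. a \<notin> P \<and> b \<notin> P})"
    if "x \<in> S" for x
    using that orbit_eqI_permutation[OF assms(1), of a x] orbit_eqI_permutation[OF assms(1), of b x]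
    by blast
  then show ?thesis using assms(2,3) by blast
qed

text \<open>Only the orbits through \<open>a\<close> or \<open>b\<close> can differ:
  \<open>q\<close> has two of them, the product one.\<close>

lemma num_orbits_merge:
  assumes q: "q permutes S" and S: "finite S" and ab: "a \<in> S" "b \<in> S" and b: "b \<notin> orbit q a"
  shows "num_orbits q S = Suc (num_orbits (q \<circ> transpose a b) S)"
proof -
  let ?q = "q \<circ> transpose a b"
  let ?N = "{P \<in> orbit q ` S. a \<notin> P \<and> b \<notin> P}"
  have pq: "permutation q" using q S permutation_permutes by blast
  have pq': "permutation ?q"
    using pq by (simp add: permutation_compose permutation_swap_id)
  have self: "a \<in> orbit q a" "b \<in> orbit q b"
    using permutation_self_in_orbit[OF pq] by auto
  have "a \<in> orbit ?q a" "b \<in> orbit ?q a"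
    using self orbit_transpose_merge[OF pq b] by auto
  then have "orbit ?q b = orbit ?q a" using orbit_eq_iff[OF pq'] by auto
  then have "orbit ?q ` S = insert (orbit ?q a) ?N"
    using orbits_split[OF pq' ab] orbits_transpose_avoiding[OF pq, of a b S] by auto
  then have 1: "num_orbits ?q S = Suc (card ?N)"
    using \<open>a \<in> orbit ?q a\<close> S by (simp add: num_orbits_def)
  have "orbit q a \<noteq> orbit q b" using b self by auto
  then have 2: "card (insert (orbit q a) (insert (orbit q b) ?N)) = Suc (Suc (card ?N))"
    using self S by simp
  show ?thesis unfolding 1 using 2 orbits_split[OF pq ab] by (simp add: num_orbits_def)
qed

text \<open>Among the orbits through \<open>a\<close> or \<open>b\<close>, \<open>q\<close> has at
  least one and the product at most two.\<close>

lemma num_orbits_transpose_le: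
  assumes q: "q permutes S" and S: "finite S" and ab: "a \<in> S" "b \<in> S"
  shows "num_orbits (q \<circ> transpose a b) S \<le> Suc (num_orbits q S)"
proof -
  let ?q = "q \<circ> transpose a b"
  let ?N = "{P \<in> orbit q ` S. a \<notin> P \<and> b \<notin> P}"
  have pq: "permutation q" using q S permutation_permutes by blast
  have pq': "permutation ?q"
    using pq by (simp add: permutation_compose permutation_swap_id)
  have "card (insert (orbit q a) ?N) \<le> num_orbits q S"
    unfolding num_orbits_def using ab S by (intro card_mono) auto
  then have "Suc (card ?N) \<le> num_orbits q S"
    using S permutation_self_in_orbit[OF pq, of a] by simp
  moreover have "num_orbits ?q S = card (insert (orbit ?q a) (insert (orbit ?q b) ?N))"
    using orbits_split[OF pq' ab] orbits_transpose_avoiding[OF pq, of a b S]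
    by (simp add: num_orbits_def)
  moreover have "\<dots> \<le> Suc (Suc (card ?N))"
    using S by (simp add: card_insert_if)
  ultimately show ?thesis by linarith
qed

section \<open>First-return maps and their orbits\<close>

lemma delete_outside_return:
  assumes x: "x \<in> S" and y: "y \<in> orbit p x" "y \<in> S"
  obtains m where "0 < m" "delete_outside p S x = (p ^^ m) x" "(p ^^ m) x \<in> S"
    "\<And>j. 0 < j \<Longrightarrow> j < m \<Longrightarrow> (p ^^ j) x \<notin> S"
proof -
  let ?P = "\<lambda>m. 0 < m \<and> (p ^^ m) x \<in> S"
  have "\<exists>m. ?P m" using y unfolding orbit_altdef by auto
  then have "?P (LEAST m. ?P m)" by (rule LeastI_ex)
  moreover have "\<And>j. 0 < j \<Longrightarrow> j < (LEAST m. ?P m) \<Longrightarrow> (p ^^ j) x \<notin> S"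
    using not_less_Least[where P = ?P] by blast
  moreover have "delete_outside p S x = (p ^^ (LEAST m. ?P m)) x"
    using x by (simp add: delete_outside_def)
  ultimately show ?thesis using that by metis
qed

lemma delete_outside_eqI:
  assumes "x \<in> S" "0 < m" "(p ^^ m) x \<in> S" "\<And>j. 0 < j \<Longrightarrow> j < m \<Longrightarrow> (p ^^ j) x \<notin> S"
  shows "delete_outside p S x = (p ^^ m) x"
proof -
  have "(LEAST m. 0 < m \<and> (p ^^ m) x \<in> S) = m"
    using assms by (intro Least_equality) (auto simp: not_less[symmetric])
  then show ?thesis using assms(1) by (simp add: delete_outside_def)
qed

text \<open>Any return to \<open>S\<close> after \<open>n\<close> steps is a chain of first returns,
  by strong induction on \<open>n\<close>.\<close>

lemma orbit_delete_outside:
  assumes p: "permutation p" and x: "x \<in> S"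
  shows "orbit (delete_outside p S) x = orbit p x \<inter> S"
proof
  have step: "delete_outside p S z \<in> orbit p z \<inter> S" if "z \<in> S" for z
    using delete_outside_return[OF that permutation_self_in_orbit[OF p] that]
    by (metis Int_iff funpow_in_orbit p permutation_self_in_orbit)
  show "orbit (delete_outside p S) x \<subseteq> orbit p x \<inter> S"
  proof
    fix z assume "z \<in> orbit (delete_outside p S) x"
    then show "z \<in> orbit p x \<inter> S"
      by induction (use step x in \<open>auto intro: orbit_trans\<close>)
  qed
  have "(p ^^ n) z \<in> orbit (delete_outside p S) z"
    if "z \<in> S" "0 < n" "(p ^^ n) z \<in> S" for z n
    using that
  proof (induction n arbitrary: z rule: less_induct)
    case (less n)
    obtain m where m: "0 < m" "delete_outside p S z = (p ^^ m) z" "(p ^^ m) z \<in> S"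
      "\<And>j. 0 < j \<Longrightarrow> j < m \<Longrightarrow> (p ^^ j) z \<notin> S"
      using delete_outside_return[OF less.prems(1) permutation_self_in_orbit[OF p] less.prems(1)]
      by blast
    have "m \<le> n" using m(4) less.prems by (meson not_le)
    show ?case
    proof (cases "m = n")
      case True
      then show ?thesis using m(2) orbit.base by metis
    next
      case False
      have eq: "(p ^^ (n - m)) ((p ^^ m) z) = (p ^^ n) z"
        using \<open>m \<le> n\<close> by (metis funpow_add le_add_diff_inverse2 o_apply)
      have "(p ^^ (n - m)) ((p ^^ m) z) \<in> orbit (delete_outside p S) ((p ^^ m) z)"
        using m less.prems False \<open>m \<le> n\<close> eq by (intro less.IH) auto
      then show ?thesis using eq m(2) orbit_subset by metis
    qed
  qed
  then show "orbit p x \<inter> S \<subseteq> orbit (delete_outside p S) x"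
    using x unfolding orbit_altdef[of p] by auto
qed

text \<open>Intersecting with \<open>S\<close> turns the orbits of \<open>p\<close> that meet
  \<open>S\<close> into the orbits of the first-return map. This is injective because orbits are
  disjoint or equal.\<close>

lemma num_orbits_delete_outside:
  assumes p: "p permutes A" and A: "finite A" and S: "S \<subseteq> A"
  shows "num_orbits p A =
    num_orbits (delete_outside p S) S + card {P \<in> orbit p ` A. P \<inter> S = {}}"
proof -
  have pp: "permutation p" using p A permutation_permutes by blast
  have "num_orbits (delete_outside p S) S = card ((\<lambda>P. P \<inter> S) ` orbit p ` S)"
    unfolding num_orbits_def image_image by (simp add: orbit_delete_outside[OF pp] cong: image_cong)
  also have "\<dots> = card (orbit p ` S)"
  proof (rule card_image, rule inj_onI)
    fix P Q assume "P \<in> orbit p ` S" "Q \<in> orbit p ` S" and eq: "P \<inter> S = Q \<inter> S"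
    then obtain x y where "x \<in> S" "P = orbit p x" "Q = orbit p y" by blast
    moreover from this have "x \<in> orbit p y"
      using eq permutation_self_in_orbit[OF pp, of x] by blast
    ultimately show "P = Q" using orbit_eqI_permutation[OF pp] by blast
  qed
  finally have "num_orbits (delete_outside p S) S = card (orbit p ` S)" .
  moreover have "orbit p ` A = orbit p ` S \<union> {P \<in> orbit p ` A. P \<inter> S = {}}"
  proof -
    have "orbit p x \<in> orbit p ` S" if "z \<in> orbit p x" "z \<in> S" for x z
      using that orbit_eqI_permutation[OF pp, of z x] by (metis imageI)
    then show ?thesis using S by blast
  qed
  moreover have "orbit p ` S \<inter> {P \<in> orbit p ` A. P \<inter> S = {}} = {}"
    using permutation_self_in_orbit[OF pp] by blast
  moreover have "finite (orbit p ` S)" "finite {P \<in> orbit p ` A. P \<inter> S = {}}"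
    using A S finite_subset by auto
  ultimately show ?thesis
    unfolding num_orbits_def by (metis card_Un_disjoint)
qed

text \<open>For \<open>b\<close> on the cycle of \<open>a\<close> and different from it, the arc
  omits \<open>a\<close> and contains \<open>b\<close>. This half-open form stays invariant when the
  chord from \<open>a\<close> to \<open>b\<close> is toggled, since \<open>b\<close> is then
  followed by \<open>p a\<close>.\<close>

definition arc :: "('a \<Rightarrow> 'a) \<Rightarrow> 'a \<Rightarrow> 'a \<Rightarrow> 'a set" where
  "arc p a b = {(p ^^ i) a | i. 0 < i \<and> i \<le> funpow_dist p a b}"

lemma arcI: "(p ^^ i) a = x \<Longrightarrow> 0 < i \<Longrightarrow> i \<le> funpow_dist p a b \<Longrightarrow> x \<in> arc p a b"
  unfolding arc_def by blast

lemma arcE: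
  assumes "x \<in> arc p a b"
  obtains i where "(p ^^ i) a = x" "0 < i" "i \<le> funpow_dist p a b"
  using assms unfolding arc_def by blast

text \<open>Translates arcs into the distance comparisons of
  \<open>chords_intersect\<close>.\<close>

lemma mem_arc_iff:
  assumes "x \<in> orbit p a" "x \<noteq> a"
  shows "x \<in> arc p a b \<longleftrightarrow> funpow_dist p a x \<le> funpow_dist p a b"
proof
  assume "x \<in> arc p a b"
  then obtain i where "(p ^^ i) a = x" "i \<le> funpow_dist p a b" by (rule arcE)
  moreover from this have "funpow_dist p a x \<le> i"
    unfolding funpow_dist_def by (intro Least_le) simp
  ultimately show "funpow_dist p a x \<le> funpow_dist p a b" by simp
next
  assume "funpow_dist p a x \<le> funpow_dist p a b"
  moreover have "(p ^^ funpow_dist p a x) a = x" using funpow_dist_prop[OF assms(1)] .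
  moreover have "0 < funpow_dist p a x" using funpow_dist_0_eq[OF assms(1)] assms(2) by simp
  ultimately show "x \<in> arc p a b" using arcI by metis
qed

text \<open>A return to \<open>a\<close> on the way could be skipped, and \<open>b\<close> would be
  reached in fewer than \<open>funpow_dist p a b\<close> steps.\<close>

lemma start_notin_arc:
  assumes "b \<in> orbit p a" "a \<noteq> b"
  shows "a \<notin> arc p a b"
proof
  let ?d = "funpow_dist p a b"
  assume "a \<in> arc p a b"
  then obtain i where i: "(p ^^ i) a = a" "0 < i" "i \<le> ?d" by (rule arcE)
  have "(p ^^ (?d - i)) a = (p ^^ (?d - i)) ((p ^^ i) a)" using i by simp
  also have "\<dots> = (p ^^ ?d) a" using i(3) by (metis funpow_add le_add_diff_inverse2 o_apply)
  also have "\<dots> = b" by (rule funpow_dist_prop[OF assms(1)])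
  finally show False using funpow_dist_least[of "?d - i" p a b] i by simp
qed

text \<open>The start \<open>a\<close> is allowed for \<open>z\<close> because toggling the chord
  replaces \<open>b\<close> by \<open>a\<close> before \<open>p\<close> is applied.\<close>

lemma arc_step:
  assumes "b \<in> orbit p a" "z \<in> insert a (arc p a b)" "z \<noteq> b"
  shows "p z \<in> arc p a b"
proof -
  obtain i where i: "(p ^^ i) a = z" "i \<le> funpow_dist p a b"
  proof (cases "z = a")
    case True
    then show ?thesis using that[of 0] by simp
  next
    case False
    then have "z \<in> arc p a b" using assms(2) by blast
    then show ?thesis using that by (metis arcE)
  qed
  moreover have "i \<noteq> funpow_dist p a b" using i assms(3) funpow_dist_prop[OF assms(1)] by auto
  ultimately show ?thesis by (intro arcI[of "Suc i"]) auto
qed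

section \<open>Components of multigraphs\<close>

text \<open>Sending \<open>f x\<close> to \<open>g x\<close> is a well-defined bijection. This
  compares numbers of components that come from different relations.\<close>

lemma card_image_eq_if_same_kernel:
  assumes "\<And>x y. x \<in> A \<Longrightarrow> y \<in> A \<Longrightarrow> f x = f y \<longleftrightarrow> g x = g y"
  shows "card (f ` A) = card (g ` A)"
proof -
  define h where "h X = g (SOME x. x \<in> A \<and> f x = X)" for X
  have h: "h (f x) = g x" if "x \<in> A" for x
  proof -
    have "\<exists>y. y \<in> A \<and> f y = f x" using that by blast
    from someI_ex[OF this] show ?thesis unfolding h_def using assms that by blast
  qed
  have "inj_on h (f ` A)"
    using h assms by (auto simp: inj_on_def)
  moreover have "h ` f ` A = g ` A"
    unfolding image_image using h by (rule image_cong[OF refl])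
  ultimately show ?thesis using card_image by metis
qed

section \<open>Connectivity through a set of edges\<close>

definition madj :: "('v, 'e) multigraph \<Rightarrow> 'e set \<Rightarrow> 'v rel" where
  "madj M W = {(u, v). \<exists>e\<in>W. u \<in> mends M e \<and> v \<in> mends M e}"

definition mconn :: "('v, 'e) multigraph \<Rightarrow> 'e set \<Rightarrow> 'v rel" where
  "mconn M W = (madj M W)\<^sup>*"

lemma mconn_refl [simp]: "(u, u) \<in> mconn M W"
  by (simp add: mconn_def)

lemma mconn_sym: "(u, v) \<in> mconn M W \<Longrightarrow> (v, u) \<in> mconn M W"
  unfolding mconn_def by (rule symD[OF sym_rtrancl]) (auto simp: sym_def madj_def)

lemma mconn_trans: "(u, v) \<in> mconn M W \<Longrightarrow> (v, w) \<in> mconn M W \<Longrightarrow> (u, w) \<in> mconn M W"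
  unfolding mconn_def by (rule rtrancl_trans)

lemma mconn_edge: "e \<in> W \<Longrightarrow> u \<in> mends M e \<Longrightarrow> v \<in> mends M e \<Longrightarrow> (u, v) \<in> mconn M W"
  unfolding mconn_def madj_def by blast

lemma mconn_mono: "W \<subseteq> W' \<Longrightarrow> mconn M W \<subseteq> mconn M W'"
  unfolding mconn_def madj_def by (rule rtrancl_mono) blast

lemma mconn_class_eq_iff: "mconn M W `` {u} = mconn M W `` {v} \<longleftrightarrow> (u, v) \<in> mconn M W"
proof
  assume "mconn M W `` {u} = mconn M W `` {v}"
  moreover have "v \<in> mconn M W `` {v}" by simp
  ultimately show "(u, v) \<in> mconn M W" by blast
next
  assume "(u, v) \<in> mconn M W"
  from mconn_trans[OF this] mconn_trans[OF mconn_sym[OF this]]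
  show "mconn M W `` {u} = mconn M W `` {v}" by blast
qed

lemma mcomponents_eq: "mcomponents M W = (\<lambda>u. mconn M W `` {u}) ` mverts M"
  unfolding mcomponents_def mconn_def madj_def quotient_def by auto

lemma mk_eq: "mk M W = card ((\<lambda>u. mconn M W `` {u}) ` mverts M)"
  by (simp add: mk_def mcomponents_eq)

lemma mk_empty: "mk M {} = card (mverts M)"
proof -
  have "mconn M {} = Id" by (simp add: mconn_def madj_def)
  then show ?thesis unfolding mk_eq by (simp add: card_image)
qed

lemma mk_insert_same:
  assumes "\<And>u v. u \<in> mends M e \<Longrightarrow> v \<in> mends M e \<Longrightarrow> (u, v) \<in> mconn M W"
  shows "mk M (insert e W) = mk M W"
proof -
  have "madj M (insert e W) \<subseteq> mconn M W"
    using assms mconn_edge unfolding madj_def by fastforce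
  then have "mconn M (insert e W) \<subseteq> mconn M W"
    unfolding mconn_def by (metis rtrancl_idemp rtrancl_mono)
  then have "mconn M (insert e W) = mconn M W"
    using mconn_mono[of W "insert e W" M] by blast
  then show ?thesis by (simp add: mk_eq)
qed

text \<open>A path that uses \<open>e\<close> meets an end of \<open>e\<close> before its first and
  after its last use, so \<open>W\<close> alone already joins \<open>x\<close> and \<open>y\<close>
  to ends of \<open>e\<close>.\<close>

lemma mconn_insert_cases:
  assumes e: "mends M e = {u, v}" and xy: "(x, y) \<in> mconn M (insert e W)"
  shows "(x, y) \<in> mconn M W \<or>
    (\<exists>s\<in>{u, v}. (s, x) \<in> mconn M W) \<and> (\<exists>s\<in>{u, v}. (s, y) \<in> mconn M W)"
  using xy unfolding mconn_def[of M "insert e W"]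
proof (induction rule: rtrancl_induct)
  case base
  show ?case by simp
next
  case (step y z)
  from step.hyps(2) consider "(y, z) \<in> mconn M W" | "y \<in> {u, v}" "z \<in> {u, v}"
    using e mconn_edge unfolding madj_def by fastforce
  then show ?case
  proof cases
    case 1
    with step.IH show ?thesis by (meson mconn_trans)
  next
    case 2
    with step.IH show ?thesis by (meson mconn_refl mconn_sym)
  qed
qed

text \<open>Adding \<open>e\<close> can only fuse the components of \<open>u\<close> and
  \<open>v\<close>. Once the component of \<open>u\<close> is left aside, the others stay
  distinct.\<close>

lemma mk_le_Suc_mk_insert:
  assumes fin: "finite (mverts M)" and e: "mends M e = {u, v}"
  shows "mk M W \<le> Suc (mk M (insert e W))"
proof -
  define N where "N = {x \<in> mverts M. (u, x) \<notin> mconn M W}"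
  let ?cl = "\<lambda>x. mconn M W `` {x}" and ?cl' = "\<lambda>x. mconn M (insert e W) `` {x}"
  have same: "?cl x = ?cl y \<longleftrightarrow> ?cl' x = ?cl' y" if "x \<in> N" "y \<in> N" for x y
  proof
    assume "?cl x = ?cl y"
    then show "?cl' x = ?cl' y"
      unfolding mconn_class_eq_iff using mconn_mono[of W "insert e W" M] by blast
  next
    assume "?cl' x = ?cl' y"
    then have "(x, y) \<in> mconn M (insert e W)" by (simp add: mconn_class_eq_iff)
    from mconn_insert_cases[OF e this] that
    show "?cl x = ?cl y" unfolding mconn_class_eq_iff N_def
      by (auto intro: mconn_trans mconn_sym)
  qed
  have "?cl ` mverts M \<subseteq> insert (?cl u) (?cl ` N)"
    unfolding N_def using mconn_class_eq_iff[of M W u] by auto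
  then have "mk M W \<le> card (insert (?cl u) (?cl ` N))"
    unfolding mk_eq using fin by (intro card_mono) (auto simp: N_def)
  also have "\<dots> \<le> Suc (card (?cl ` N))"
    by (rule card_insert_le_m1) auto
  also have "card (?cl ` N) = card (?cl' ` N)"
    using same by (rule card_image_eq_if_same_kernel)
  also have "\<dots> \<le> mk M (insert e W)"
    unfolding mk_eq using fin by (intro card_mono) (auto simp: N_def)
  finally show ?thesis by simp
qed

text \<open>Used to see that the subtraction in \<open>mnullity\<close> does not truncate.\<close>

lemma mk_le_card_plus_mk_Un:
  assumes "finite (mverts M)" "finite S" "\<And>e. e \<in> S \<Longrightarrow> \<exists>u v. mends M e = {u, v}"
  shows "mk M W \<le> card S + mk M (W \<union> S)"
  using assms(2,3)
proof (induction S rule: finite_induct)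
  case empty
  then show ?case by simp
next
  case (insert e S)
  then obtain u v where "mends M e = {u, v}" by blast
  from mk_le_Suc_mk_insert[OF assms(1) this, of "W \<union> S"] insert show ?case by simp
qed

text \<open>Walks project to the contracted graph, where edges of \<open>D\<close> become
  stationary, and they lift back because each class is connected by \<open>D\<close>.\<close>

lemma mk_contract:
  assumes ends: "\<And>e. e \<in> D \<union> S \<Longrightarrow> mends M e \<subseteq> mverts M"
    and M': "mverts M' = mcomponents M D"
      "\<And>e. e \<in> S \<Longrightarrow> mends M' e = {c \<in> mcomponents M D. c \<inter> mends M e \<noteq> {}}"
  shows "mk M' S = mk M (D \<union> S)"
proof -
  let ?h = "\<lambda>x. mconn M D `` {x}"
  have to: "x \<in> mverts M \<Longrightarrow> y \<in> mverts M \<and> (?h x, ?h y) \<in> mconn M' S"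
    if "(x, y) \<in> mconn M (D \<union> S)" for x y
    using that unfolding mconn_def[of M "D \<union> S"]
  proof (induction rule: rtrancl_induct)
    case base
    then show ?case by simp
  next
    case (step y z)
    then obtain e where e: "e \<in> D \<union> S" "y \<in> mends M e" "z \<in> mends M e"
      unfolding madj_def by blast
    then have yz: "y \<in> mverts M" "z \<in> mverts M" using ends by blast+
    show ?case
    proof (cases "e \<in> D")
      case True
      then have "?h y = ?h z" unfolding mconn_class_eq_iff using e mconn_edge by metis
      then show ?thesis using step yz by metis
    next
      case False
      then have "e \<in> S" using e by blast
      moreover have "?h w \<in> mends M' e" if "w \<in> mverts M" "w \<in> mends M e" for w
      proof -
        have "w \<in> ?h w" by simp
        moreover have "?h w \<in> mcomponents M D" using that(1) by (simp add: mcomponents_eq)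
        ultimately show ?thesis using M'(2)[OF \<open>e \<in> S\<close>] that(2) by blast
      qed
      note this[OF yz(1) e(2)] this[OF yz(2) e(3)]
      ultimately have "(?h y, ?h z) \<in> mconn M' S" by (rule mconn_edge)
      then show ?thesis using step yz mconn_trans by metis
    qed
  qed
  \<comment> \<open>A walk of classes singles out no representative of its last class, hence the
    quantifier over \<open>d\<close>.\<close>
  have from_step: "\<forall>y\<in>d. (x, y) \<in> mconn M (D \<union> S)"
    if "(?h x, d) \<in> mconn M' S" for x d
    using that unfolding mconn_def[of M' S]
  proof (induction rule: rtrancl_induct)
    case base
    then show ?case using mconn_mono[of D "D \<union> S" M] by blast
  next
    case (step c d)
    then obtain e where e: "e \<in> S" "c \<in> mends M' e" "d \<in> mends M' e"
      unfolding madj_def by blast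
    then have "c \<inter> mends M e \<noteq> {}" "d \<inter> mends M e \<noteq> {}" and d: "d \<in> mcomponents M D"
      by (simp_all add: M'(2))
    then obtain w w' where w: "w \<in> c" "w \<in> mends M e" "w' \<in> d" "w' \<in> mends M e"
      by blast
    have "(x, w') \<in> mconn M (D \<union> S)"
      using step.IH w mconn_edge[of e "D \<union> S" w M w'] e(1) mconn_trans by (metis UnI2)
    moreover have "(w', y) \<in> mconn M (D \<union> S)" if "y \<in> d" for y
    proof -
      have "(w', y) \<in> mconn M D"
        using d w(3) that mconn_sym mconn_trans unfolding mcomponents_eq
        by (metis (no_types, lifting) Image_singleton_iff imageE)
      then show ?thesis using mconn_mono[of D "D \<union> S" M] by blast
    qed
    ultimately show ?case using mconn_trans by metis
  qed
  have "mk M' S = card ((\<lambda>x. mconn M' S `` {?h x}) ` mverts M)"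
    unfolding mk_eq M' mcomponents_eq image_image ..
  also have "\<dots> = card ((\<lambda>x. mconn M (D \<union> S) `` {x}) ` mverts M)"
  proof (rule card_image_eq_if_same_kernel)
    fix x y assume "x \<in> mverts M" "y \<in> mverts M"
    then show "mconn M' S `` {?h x} = mconn M' S `` {?h y} \<longleftrightarrow>
        mconn M (D \<union> S) `` {x} = mconn M (D \<union> S) `` {y}"
      unfolding mconn_class_eq_iff using to from_step[of x "?h y"]
      by (meson Image_singleton_iff mconn_refl)
  qed
  finally show ?thesis by (simp add: mk_eq)
qed

section \<open>Boundary curves of spanning subgraphs\<close>

locale ribbon =
  fixes G :: ribbon_graph
  assumes ribbon: "is_ribbon_graph G"
begin

abbreviation "\<Omega> \<equiv> half_edges G"

lemma finite_half_edges [simp]: "finite \<Omega>"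
  by (simp add: half_edges_def)

lemma sigma0_permutes: "sigma0 G permutes \<Omega>"
  and sigma1_permutes: "sigma1 G permutes \<Omega>"
  using ribbon by (auto simp: is_ribbon_graph_def)

lemma sigma1_neq: "i \<in> \<Omega> \<Longrightarrow> sigma1 G i \<noteq> i"
  using ribbon by (auto simp: is_ribbon_graph_def)

lemma sigma1_involution [simp]: "sigma1 G (sigma1 G i) = i"
  using ribbon permutes_not_in[OF sigma1_permutes] unfolding is_ribbon_graph_def by metis

lemma sigma1_in_iff [simp]: "sigma1 G i \<in> \<Omega> \<longleftrightarrow> i \<in> \<Omega>"
  using permutes_in_image[OF sigma1_permutes] .

lemma orbit_sigma1: "orbit (sigma1 G) i = {i, sigma1 G i}"
proof
  show "orbit (sigma1 G) i \<subseteq> {i, sigma1 G i}"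
  proof
    fix x assume "x \<in> orbit (sigma1 G) i"
    then show "x \<in> {i, sigma1 G i}" by induction auto
  qed
  have "sigma1 G (sigma1 G i) \<in> orbit (sigma1 G) i"
    by (intro orbit.intros)
  then show "{i, sigma1 G i} \<subseteq> orbit (sigma1 G) i"
    by (auto intro: orbit.base)
qed

lemma edges_eq: "edges G = (\<lambda>i. {i, sigma1 G i}) ` \<Omega>"
  by (simp add: edges_def orbit_sigma1)

lemma finite_edges [simp]: "finite (edges G)"
  by (simp add: edges_def)

lemma edge_eq: "e \<in> edges G \<Longrightarrow> x \<in> e \<Longrightarrow> e = {x, sigma1 G x}"
  unfolding edges_eq by auto

lemma edge_subset: "e \<in> edges G \<Longrightarrow> e \<subseteq> \<Omega>"
  unfolding edges_eq by auto

lemma edge_obtain: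
  assumes "e \<in> edges G"
  obtains a b where "e = {a, b}" "a \<in> \<Omega>" "b \<in> \<Omega>" "a \<noteq> b" "b = sigma1 G a"
proof -
  from assms obtain a where "a \<in> \<Omega>" "e = {a, sigma1 G a}" unfolding edges_eq by blast
  then show ?thesis using that sigma1_neq[of a] by auto
qed

lemma mem_Union_edges_iff:
  assumes "H \<subseteq> edges G"
  shows "x \<in> \<Union>H \<longleftrightarrow> {x, sigma1 G x} \<in> H"
  using assms edge_eq by (metis UnionE UnionI insertI1 subsetD)

lemma Union_edges_subset: "H \<subseteq> edges G \<Longrightarrow> \<Union>H \<subseteq> \<Omega>"
  using edge_subset by blast

lemma sigma1_mem_Union: "H \<subseteq> edges G \<Longrightarrow> sigma1 G x \<in> \<Union>H \<longleftrightarrow> x \<in> \<Union>H"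
  using mem_Union_edges_iff by (metis insert_commute sigma1_involution)

lemma curve_next_outside: "x \<notin> \<Union>H \<Longrightarrow> curve_next G H x = sigma0 G x"
  unfolding curve_next_def by (rule if_not_P)

lemma curve_next_eq_comp: "curve_next G H = sigma0 G \<circ> perm_restrict (sigma1 G) (\<Union>H)"
  by (auto simp: curve_next_def perm_restrict_def)

lemma curve_next_permutes:
  assumes "H \<subseteq> edges G"
  shows "curve_next G H permutes \<Omega>"
proof -
  let ?t = "perm_restrict (sigma1 G) (\<Union>H)"
  have "?t (?t x) = x" for x
    using sigma1_mem_Union[OF assms] by (auto simp: perm_restrict_def)
  moreover have "?t x = x" if "x \<notin> \<Omega>" for x
    using Union_edges_subset[OF assms] that by (auto simp: perm_restrict_def)
  ultimately have "?t permutes \<Omega>" unfolding permutes_def by metis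
  then show ?thesis
    unfolding curve_next_eq_comp using permutes_compose sigma0_permutes by metis
qed

lemma permutation_curve_next: "H \<subseteq> edges G \<Longrightarrow> permutation (curve_next G H)"
  using curve_next_permutes permutation_permutes finite_half_edges by blast

text \<open>On the half-edges of \<open>A\<close> membership in \<open>H\<close> is flipped; as
  \<open>sigma1\<close> is an involution, precomposing with it exchanges the two branches of
  \<open>curve_next\<close>.\<close>

lemma curve_next_sym_diff:
  assumes "H \<subseteq> edges G" "A \<subseteq> edges G"
  shows "curve_next G (sym_diff H A) x =
    curve_next G H (if x \<in> \<Union>A then sigma1 G x else x)"
proof -
  have "sym_diff H A \<subseteq> edges G" using assms by blast
  from mem_Union_edges_iff[OF this] mem_Union_edges_iff[OF assms(1)] mem_Union_edges_iff[OF assms(2)]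
  show ?thesis
    by (auto simp: curve_next_def insert_commute)
qed

lemma curve_next_toggle:
  assumes "H \<subseteq> edges G" "e \<in> edges G" "e = {a, b}" "a \<noteq> b"
  shows "curve_next G (sym_diff H {e}) = curve_next G H \<circ> transpose a b"
proof
  fix x
  have "b = sigma1 G a" using edge_eq[OF assms(2), of a] assms(3,4) by auto
  then show "curve_next G (sym_diff H {e}) x = (curve_next G H \<circ> transpose a b) x"
    using assms by (subst curve_next_sym_diff) (auto simp: transpose_def)
qed

lemma curve_next_insert:
  assumes "H \<subseteq> edges G" "e \<in> edges G" "e \<notin> H" "e = {a, b}" "a \<noteq> b"
  shows "curve_next G (insert e H) = curve_next G H \<circ> transpose a b"
proof -
  have "insert e H = sym_diff H {e}" using assms(3) by auto
  then show ?thesis using curve_next_toggle assms by metis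
qed

text \<open>All half-edges serve as marks on the curves, also those outside \<open>H\<close>. Curves
  around vertices without half-edges are not seen here.\<close>

definition num_curves :: "nat set set \<Rightarrow> nat" where
  "num_curves H = num_orbits (curve_next G H) \<Omega>"

lemma num_curves_toggle_merge:
  assumes "H \<subseteq> edges G" "e \<in> edges G" "e = {a, b}" "b \<notin> orbit (curve_next G H) a"
  shows "num_curves H = Suc (num_curves (sym_diff H {e}))"
proof -
  have "a \<noteq> b"
    using assms(4) permutation_self_in_orbit[OF permutation_curve_next[OF assms(1)]] by metis
  moreover have "a \<in> \<Omega>" "b \<in> \<Omega>" using edge_subset assms(2,3) by auto
  ultimately show ?thesis unfolding num_curves_def
    using curve_next_toggle[OF assms(1-3)]
      num_orbits_merge[OF curve_next_permutes[OF assms(1)] finite_half_edges _ _ assms(4)]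
    by simp
qed

lemma num_curves_insert_le:
  assumes "H \<subseteq> edges G" "e \<in> edges G" "e \<notin> H"
  shows "num_curves (insert e H) \<le> Suc (num_curves H)"
proof -
  obtain a b where "e = {a, b}" "a \<in> \<Omega>" "b \<in> \<Omega>" "a \<noteq> b"
    using edge_obtain[OF assms(2)] by metis
  then show ?thesis
    unfolding num_curves_def curve_next_insert[OF assms \<open>e = {a, b}\<close> \<open>a \<noteq> b\<close>]
    by (intro num_orbits_transpose_le curve_next_permutes assms) auto
qed

text \<open>After crossing the edge at \<open>x\<close>, the curve follows \<open>sigma0\<close>
  until it meets \<open>H\<close> again, so both sides are the same first return.\<close>

lemma delete_outside_curve_next:
  assumes H: "H \<subseteq> edges G" and x: "x \<in> \<Union>H"
  shows "(delete_outside (sigma0 G) (\<Union>H) \<circ> delete_outside (sigma1 G) (\<Union>H)) x =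
    delete_outside (curve_next G H) (\<Union>H) x"
proof -
  let ?S = "\<Union>H" and ?q = "curve_next G H"
  have s1x: "sigma1 G x \<in> ?S" using x sigma1_mem_Union[OF H] by blast
  have "delete_outside (sigma1 G) ?S x = (sigma1 G ^^ 1) x"
    by (rule delete_outside_eqI) (use x s1x in auto)
  then have 1: "delete_outside (sigma1 G) ?S x = sigma1 G x" by simp
  have "permutation (sigma0 G)"
    using sigma0_permutes permutation_permutes finite_half_edges by blast
  then obtain m where m: "0 < m" "delete_outside (sigma0 G) ?S (sigma1 G x) = (sigma0 G ^^ m) (sigma1 G x)"
    "(sigma0 G ^^ m) (sigma1 G x) \<in> ?S"
    "\<And>j. 0 < j \<Longrightarrow> j < m \<Longrightarrow> (sigma0 G ^^ j) (sigma1 G x) \<notin> ?S"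
    using delete_outside_return[OF s1x permutation_self_in_orbit s1x] by metis
  have pow: "(?q ^^ j) x = (sigma0 G ^^ j) (sigma1 G x)" if "0 < j" "j \<le> m" for j
    using that
  proof (induction j)
    case 0
    then show ?case by simp
  next
    case (Suc j)
    show ?case
    proof (cases "j = 0")
      case True
      then show ?thesis using x by (simp add: curve_next_def)
    next
      case False
      then have "(?q ^^ j) x = (sigma0 G ^^ j) (sigma1 G x)" using Suc by simp
      moreover have "(sigma0 G ^^ j) (sigma1 G x) \<notin> ?S" using m(4) False Suc.prems by simp
      ultimately show ?thesis using curve_next_outside[of "(?q ^^ j) x" H] by simp
    qed
  qed
  have "delete_outside ?q ?S x = (?q ^^ m) x"
    by (rule delete_outside_eqI) (use x m pow in auto)
  then show ?thesis using m pow 1 by simp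
qed

text \<open>Curves that meet \<open>H\<close> correspond to the cycles in \<open>f_rg\<close>.
  Curves that miss \<open>H\<close> are orbits of \<open>sigma0\<close>, that is, isolated vertices
  of \<open>H\<close> with half-edges; the vertices without half-edges make up
  \<open>nisolated G\<close>.\<close>

lemma f_rg_eq:
  assumes H: "H \<subseteq> edges G"
  shows "f_rg G H = num_curves H + nisolated G"
proof -
  let ?S = "\<Union>H" and ?q = "curve_next G H"
  let ?p = "delete_outside (sigma0 G) ?S \<circ> delete_outside (sigma1 G) ?S"
  have pq: "permutation ?q" by (rule permutation_curve_next[OF H])
  have p0: "permutation (sigma0 G)"
    using sigma0_permutes permutation_permutes finite_half_edges by blast
  have "orbit ?p x = orbit (delete_outside ?q ?S) x" if "x \<in> ?S" for x
  proof (rule orbit_cong0[OF that])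
    show "?p y = delete_outside ?q ?S y" if "y \<in> ?S" for y
      by (rule delete_outside_curve_next[OF H that])
    have "delete_outside ?q ?S y \<in> ?S" if "y \<in> ?S" for y
      using delete_outside_return[OF that permutation_self_in_orbit[OF pq] that] by metis
    then show "?p \<in> ?S \<rightarrow> ?S" using delete_outside_curve_next[OF H] by simp
  qed
  then have 1: "orbit ?p ` ?S = orbit (delete_outside ?q ?S) ` ?S" by (rule image_cong[OF refl])
  \<comment> \<open>The two maps agree outside \<open>\<Union>H\<close>, so disjointness of either
    orbit makes the orbits equal.\<close>
  have q0: "orbit ?q x = orbit (sigma0 G) x"
    if "orbit ?q x \<inter> ?S = {} \<or> orbit (sigma0 G) x \<inter> ?S = {}" for x
    using that
  proof
    assume "orbit ?q x \<inter> ?S = {}"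
    then show ?thesis
      by (intro orbit_cong[symmetric] permutation_self_in_orbit[OF pq])
        (metis curve_next_outside disjoint_iff)
  next
    assume "orbit (sigma0 G) x \<inter> ?S = {}"
    then show ?thesis
      by (intro orbit_cong permutation_self_in_orbit[OF p0])
        (metis curve_next_outside disjoint_iff)
  qed
  have 2: "{P \<in> orbit ?q ` \<Omega>. P \<inter> ?S = {}} = {P \<in> orbit (sigma0 G) ` \<Omega>. P \<inter> ?S = {}}"
    (is "?A = ?B")
  proof -
    have "?A = orbit ?q ` {x \<in> \<Omega>. orbit ?q x \<inter> ?S = {}}" by blast
    also have "\<dots> = orbit (sigma0 G) ` {x \<in> \<Omega>. orbit (sigma0 G) x \<inter> ?S = {}}"
      using q0 by (intro image_cong) auto
    also have "\<dots> = ?B" by blast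
    finally show ?thesis .
  qed
  have iso: "(\<forall>e\<in>H. Inl (orbit (sigma0 G) i) \<notin> ends G e) \<longleftrightarrow> orbit (sigma0 G) i \<inter> ?S = {}" for i
  proof -
    have "Inl (orbit (sigma0 G) i) \<in> ends G e \<longleftrightarrow> (\<exists>j\<in>e. j \<in> orbit (sigma0 G) i)" for e
      unfolding ends_def image_iff using orbit_eq_iff[OF p0] by (metis Inl_inject)
    then show ?thesis by blast
  qed
  have "{v \<in> verts G. \<forall>e\<in>H. v \<notin> ends G e} =
      Inl ` {P \<in> orbit (sigma0 G) ` \<Omega>. P \<inter> ?S = {}} \<union> Inr ` {..<nisolated G}" (is "?V = ?W")
  proof (rule set_eqI)
    fix v
    show "v \<in> ?V \<longleftrightarrow> v \<in> ?W"
    proof (cases v)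
      case (Inl P)
      then show ?thesis using iso by (auto simp: verts_def)
    next
      case (Inr k)
      then show ?thesis by (auto simp: verts_def ends_def)
    qed
  qed
  also have "card \<dots> = card {P \<in> orbit (sigma0 G) ` \<Omega>. P \<inter> ?S = {}} + nisolated G"
    by (subst card_Un_disjoint) (auto simp: card_image)
  finally show ?thesis
    unfolding f_rg_def 1 num_curves_def
    using num_orbits_delete_outside[OF curve_next_permutes[OF H] finite_half_edges Union_edges_subset[OF H]]
    by (simp add: 2 num_orbits_def)
qed

lemma f_rg_toggle_merge:
  assumes "H \<subseteq> edges G" "e \<in> edges G" "e = {a, b}" "b \<notin> orbit (curve_next G H) a"
  shows "f_rg G H = Suc (f_rg G (sym_diff H {e}))"
proof -
  have "sym_diff H {e} \<subseteq> edges G" using assms by blast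
  then show ?thesis using num_curves_toggle_merge[OF assms] f_rg_eq assms(1) by simp
qed

lemma f_rg_insert_le:
  assumes "H \<subseteq> edges G" "e \<in> edges G" "e \<notin> H"
  shows "f_rg G (insert e H) \<le> Suc (f_rg G H)"
  using num_curves_insert_le[OF assms] f_rg_eq assms by simp

text \<open>As soon as there is a half-edge, at least one curve is counted by
  \<open>num_curves\<close>, so the single face must be that curve.\<close>

lemma f_rg_1_imp_single_curve:
  assumes Q: "Q \<subseteq> edges G" "f_rg G Q = 1" and "x \<in> \<Omega>" "y \<in> \<Omega>"
  shows "y \<in> orbit (curve_next G Q) x"
proof -
  have "num_curves Q > 0"
    using assms(3) unfolding num_curves_def num_orbits_def by (auto simp: card_gt_0_iff)
  then have "num_orbits (curve_next G Q) \<Omega> = 1"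
    using f_rg_eq[OF Q(1)] Q(2) unfolding num_curves_def by simp
  then show ?thesis
    using num_orbits_eq_1[OF permutation_curve_next[OF Q(1)] finite_half_edges] assms(3,4) by blast
qed

section \<open>Connected components and Euler's inequality\<close>

abbreviation vert :: "nat \<Rightarrow> nat set + nat" where
  "vert i \<equiv> Inl (orbit (sigma0 G) i)"

abbreviation conn :: "nat set set \<Rightarrow> (nat set + nat) rel" where
  "conn H \<equiv> mconn (underlying G) H"

lemma underlying_simps [simp]:
  "mverts (underlying G) = verts G" "medges (underlying G) = edges G"
  "mends (underlying G) e = ends G e"
  by (simp_all add: underlying_def)

lemma finite_verts [simp]: "finite (verts G)"
  by (simp add: verts_def)

lemma ends_subset: "e \<in> edges G \<Longrightarrow> ends G e \<subseteq> verts G"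
  using edge_subset unfolding ends_def verts_def by blast

lemma ends_pair: "ends G {a, b} = {vert a, vert b}"
  by (simp add: ends_def)

lemma edge_ends_pair: "e \<in> edges G \<Longrightarrow> \<exists>u v. ends G e = {u, v}"
  using ends_pair edge_obtain by metis

lemma vert_sigma0: "vert (sigma0 G i) = vert i"
  using permutation_orbit_step[of "sigma0 G" i] sigma0_permutes permutation_permutes
    finite_half_edges by blast

lemma conn_sigma1:
  assumes "H \<subseteq> edges G" "x \<in> \<Union>H"
  shows "(vert x, vert (sigma1 G x)) \<in> conn H"
proof -
  have "{x, sigma1 G x} \<in> H" using mem_Union_edges_iff assms by blast
  then show ?thesis by (rule mconn_edge) (simp_all add: ends_pair)
qed

text \<open>A step of the curve stays at a vertex by \<open>sigma0\<close>, possibly after crossing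
  an edge of \<open>H\<close>.\<close>

lemma curve_conn:
  assumes H: "H \<subseteq> edges G" and "y \<in> orbit (curve_next G H) x"
  shows "(vert x, vert y) \<in> conn H"
proof -
  have step: "(vert z, vert (curve_next G H z)) \<in> conn H" for z
    using conn_sigma1[OF H, of z] by (simp only: curve_next_def vert_sigma0 mconn_refl split: if_split) blast
  from assms(2) show ?thesis
  proof induction
    case base
    show ?case by (rule step)
  next
    case (step z)
    then show ?case using \<open>\<And>z. (vert z, vert (curve_next G H z)) \<in> conn H\<close> mconn_trans by metis
  qed
qed

lemma k_rg_le_Suc_insert:
  assumes "e \<in> edges G"
  shows "k_rg G H \<le> Suc (k_rg G (insert e H))"
  using edge_ends_pair[OF assms] mk_le_Suc_mk_insert[of "underlying G" e] unfolding k_rg_def by fastforce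

text \<open>The two sides of a bridge lie on different boundary curves.\<close>

lemma f_rg_insert_bridge:
  assumes H: "H \<subseteq> edges G" and e: "e \<in> edges G" "e \<notin> H"
    and k: "k_rg G (insert e H) \<noteq> k_rg G H"
  shows "f_rg G H = Suc (f_rg G (insert e H))"
proof -
  obtain a b where ab: "e = {a, b}" using edge_obtain[OF e(1)] by metis
  have "(vert a, vert b) \<notin> conn H"
  proof
    assume "(vert a, vert b) \<in> conn H"
    then have "mk (underlying G) (insert e H) = mk (underlying G) H"
      using mconn_sym by (intro mk_insert_same) (auto simp: ab ends_pair)
    then show False using k by (simp add: k_rg_def)
  qed
  then have "b \<notin> orbit (curve_next G H) a" using curve_conn[OF H] by blast
  from f_rg_toggle_merge[OF H e(1) ab this] show ?thesis using e(2) by (simp add: insert_absorb)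
qed

lemma f_rg_empty: "f_rg G {} = card (verts G)"
  by (simp add: f_rg_def)

text \<open>This says \<open>f \<le> k + n\<close>. An added edge either keeps \<open>k\<close> and
  raises \<open>f\<close> by at most one, or lowers \<open>k\<close> by one and \<open>f\<close> by
  one.\<close>

lemma euler_inequality:
  assumes "H \<subseteq> edges G"
  shows "f_rg G H + card (verts G) \<le> 2 * k_rg G H + card H"
  using finite_subset[OF assms finite_edges] assms
proof (induction H rule: finite_induct)
  case empty
  show ?case by (simp add: f_rg_empty k_rg_def mk_empty)
next
  case (insert e H)
  then have e: "e \<in> edges G" "e \<notin> H" and H: "H \<subseteq> edges G" by auto
  show ?case
  proof (cases "k_rg G (insert e H) = k_rg G H")
    case True
    then show ?thesis using f_rg_insert_le[OF H e] insert by simp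
  next
    case False
    then show ?thesis
      using f_rg_insert_bridge[OF H e False] k_rg_le_Suc_insert[OF e(1), of H] insert by simp
  qed
qed

section \<open>Chord diagrams\<close>

lemma edge_pair_neq:
  assumes "{a, b} \<in> edges G"
  shows "a \<in> \<Omega>" "b \<in> \<Omega>" "a \<noteq> b"
proof -
  show ab: "a \<in> \<Omega>" "b \<in> \<Omega>" using edge_subset[OF assms] by auto
  show "a \<noteq> b"
    using edge_eq[OF assms, of a] sigma1_neq[OF ab(1)] by auto
qed

lemma edges_disjoint: "e \<in> edges G \<Longrightarrow> e' \<in> edges G \<Longrightarrow> e \<noteq> e' \<Longrightarrow> e \<inter> e' = {}"
  using edge_eq by blast

text \<open>
  If no chord of \<open>A\<close> crosses \<open>e = {a, b}\<close>, then the arc from \<open>a\<close> to \<open>b\<close> contains with each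
  half-edge of \<open>A\<close> also the opposite one, and cutting along \<open>e\<close> separates the arc from its
  complement.
\<close>

lemma orbit_subset_arc:
  assumes Q: "Q \<subseteq> edges G" "f_rg G Q = 1"
    and e: "e \<in> edges G" "e = {a, b}" and A: "A \<subseteq> edges G" "e \<notin> A"
    and nc: "\<And>e'. e' \<in> A \<Longrightarrow> \<not> chords_intersect (curve_next G Q) e e'"
    and x: "x \<in> arc (curve_next G Q) a b"
  shows "orbit (curve_next G (sym_diff Q (insert e A))) x \<subseteq> arc (curve_next G Q) a b"
proof -
  define p where "p = curve_next G Q"
  let ?J = "arc p a b" and ?q = "curve_next G (sym_diff Q (insert e A))"
  have single: "v \<in> orbit p u" if "u \<in> \<Omega>" "v \<in> \<Omega>" for u v
    using f_rg_1_imp_single_curve[OF Q that] by (simp add: p_def)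
  have ab: "a \<in> \<Omega>" "b \<in> \<Omega>" "a \<noteq> b"
    using edge_pair_neq e by blast+
  have opp: "sigma1 G a = b" "sigma1 G b = a"
    using edge_eq[OF e(1), of a] edge_eq[OF e(1), of b] e(2) ab(3)
    by (metis doubleton_eq_iff insertI1 insert_commute)+
  have disj: "a \<notin> \<Union>A" "b \<notin> \<Union>A"
    using edges_disjoint[OF e(1)] A e(2) by blast+
  have J_sub: "?J \<subseteq> \<Omega>"
  proof
    fix z assume "z \<in> ?J"
    then have "z \<in> orbit p a" unfolding arc_def orbit_altdef by blast
    then show "z \<in> \<Omega>"
      using permutes_orbit_subset[OF curve_next_permutes[OF Q(1)] ab(1)] by (auto simp: p_def)
  qed
  \<comment> \<open>The chord at \<open>z\<close> does not cross \<open>e\<close>, so its other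
    half-edge also comes before \<open>b\<close>; chords are disjoint, so it is not \<open>b\<close>
    itself.\<close>
  have closed: "sigma1 G z \<in> ?J \<and> sigma1 G z \<noteq> b" if z: "z \<in> ?J" "z \<in> \<Union>A" for z
  proof -
    let ?z = "sigma1 G z"
    have e': "{z, ?z} \<in> A" using mem_Union_edges_iff[OF A(1)] z(2) by blast
    have z': "?z \<in> \<Union>A" using sigma1_mem_Union[OF A(1)] z(2) by blast
    have ne: "z \<noteq> a" "z \<noteq> b" "?z \<noteq> a" "?z \<noteq> b" using disj z(2) z' by metis+
    have in\<Omega>: "z \<in> \<Omega>" "?z \<in> \<Omega>" using z J_sub by auto
    have "funpow_dist p a z \<le> funpow_dist p a b"
      using mem_arc_iff[OF single[OF ab(1) in\<Omega>(1)] ne(1)] z by blast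
    moreover have "funpow_dist p a z \<noteq> funpow_dist p a b"
      using funpow_dist_prop[OF single[OF ab(1) in\<Omega>(1)]] funpow_dist_prop[OF single[OF ab(1,2)]] ne(2)
      by metis
    ultimately have "funpow_dist p a z < funpow_dist p a b" by simp
    then have "\<not> funpow_dist p a b < funpow_dist p a ?z"
      using nc[OF e'] e(2) unfolding chords_intersect_def p_def by blast
    then show ?thesis
      using mem_arc_iff[OF single[OF ab(1) in\<Omega>(2)] ne(3)] ne(4) by simp
  qed
  have b_orb: "b \<in> orbit p a" by (rule single[OF ab(1,2)])
  have eA: "insert e A \<subseteq> edges G" using e A by blast
  have step: "?q z \<in> ?J" if z: "z \<in> ?J" for z
  proof -
    \<comment> \<open>The toggled curve applies \<open>p\<close> to \<open>z'\<close>. For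
      \<open>z = b\<close> this is \<open>a\<close>, and \<open>p a\<close> is the first half-edge
      of the arc.\<close>
    define z' where "z' = (if z \<in> \<Union>(insert e A) then sigma1 G z else z)"
    have "z \<noteq> a" using start_notin_arc[OF b_orb ab(3)] z by blast
    then have "z' \<in> insert a ?J" "z' \<noteq> b"
      using closed[OF z] z opp ab(3) e(2) unfolding z'_def by auto
    then have "p z' \<in> ?J" by (rule arc_step[OF b_orb])
    then show ?thesis unfolding curve_next_sym_diff[OF Q(1) eA] z'_def p_def .
  qed
  show ?thesis
  proof
    fix z assume "z \<in> orbit ?q x"
    then show "z \<in> arc (curve_next G Q) a b"
      by induction (use step x in \<open>auto simp: p_def\<close>)
  qed
qed

text \<open>The arc is invariant, contains \<open>b\<close> and omits \<open>a\<close>, so the orbit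
  of \<open>b\<close> misses \<open>a\<close>.\<close>

lemma noncrossing_separates:
  assumes Q: "Q \<subseteq> edges G" "f_rg G Q = 1"
    and e: "e \<in> edges G" "e = {a, b}" and A: "A \<subseteq> edges G" "e \<notin> A"
    and nc: "\<And>e'. e' \<in> A \<Longrightarrow> \<not> chords_intersect (curve_next G Q) e e'"
  shows "b \<notin> orbit (curve_next G (sym_diff Q (insert e A))) a"
proof
  let ?q = "curve_next G (sym_diff Q (insert e A))" and ?p = "curve_next G Q"
  assume b: "b \<in> orbit ?q a"
  have "permutation ?q" using permutation_curve_next[of "sym_diff Q (insert e A)"] Q(1) e(1) A by blast
  then have "a \<in> orbit ?q b" using b orbit_eq_iff by metis
  moreover have ab: "a \<in> \<Omega>" "b \<in> \<Omega>" "a \<noteq> b"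
    using edge_pair_neq e by blast+
  moreover have orb: "b \<in> orbit ?p a" using f_rg_1_imp_single_curve[OF Q] ab by blast
  moreover have "b \<in> arc ?p a b" using mem_arc_iff[OF orb] ab by simp
  ultimately show False
    using start_notin_arc[OF orb] orbit_subset_arc[OF assms, of b] by blast
qed

text \<open>Chords are added in increasing order of \<open>\<rho>\<close>. The newest one crosses
  none of the earlier ones, so its half-edges lie on different curves, which merge when it is
  toggled back: each chord adds exactly one face.\<close>

lemma f_rg_noncrossing:
  assumes Q: "Q \<subseteq> edges G" "f_rg G Q = 1"
    and A: "A \<subseteq> edges G" and \<rho>: "inj_on \<rho> (edges G)"
    and nc: "\<And>e e'. e \<in> A \<Longrightarrow> e' \<in> A \<Longrightarrow> \<rho> e' < (\<rho> e :: nat) \<Longrightarrow>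
      \<not> chords_intersect (curve_next G Q) e e'"
  shows "f_rg G (sym_diff Q A) = Suc (card A)"
  using finite_subset[OF A finite_edges] A nc
proof (induction A rule: finite_ranking_induct[where f = \<rho>])
  case empty
  then show ?case using Q(2) by simp
next
  case (insert e A)
  show ?case
  proof (cases "e \<in> A")
    case True
    then show ?thesis using insert by (simp add: insert_absorb)
  next
    case False
    let ?H = "sym_diff Q (insert e A)"
    from insert.prems have e: "e \<in> edges G" and A: "A \<subseteq> edges G" by auto
    obtain a b where ab: "e = {a, b}" using edge_obtain[OF e] by metis
    \<comment> \<open>The ranking induction gives only a weak inequality; injectivity of
      \<open>\<rho>\<close> makes it strict.\<close>
    have "\<rho> e' < \<rho> e" if "e' \<in> A" for e'
      using insert.hyps(2)[OF that] inj_onD[OF \<rho>, of e' e] that False e A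
      by (metis le_neq_implies_less subsetD)
    then have "b \<notin> orbit (curve_next G ?H) a"
      using insert.prems by (intro noncrossing_separates[OF Q e ab A False]) auto
    moreover have "?H \<subseteq> edges G" using Q(1) e A by blast
    ultimately have "f_rg G ?H = Suc (f_rg G (sym_diff ?H {e}))"
      using f_rg_toggle_merge e ab by metis
    also have "sym_diff ?H {e} = sym_diff Q A" using False by auto
    also have "f_rg G \<dots> = Suc (card A)"
      using insert.prems by (intro insert.IH) auto
    finally show ?thesis using False insert.hyps(1) by simp
  qed
qed

text \<open>Toggling \<open>e\<close> cuts the curve into the arc and its complement. Crossing puts
  \<open>c\<close> and \<open>d\<close> on different sides, so toggling \<open>e'\<close> merges the
  two curves again.\<close>

lemma f_rg_crossing:
  assumes Q: "Q \<subseteq> edges G" "f_rg G Q = 1"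
    and e: "e \<in> edges G" "e' \<in> edges G" "e \<noteq> e'"
    and cross: "chords_intersect (curve_next G Q) e e'"
  shows "f_rg G (sym_diff Q {e, e'}) = 1"
proof -
  let ?p = "curve_next G Q" and ?H = "sym_diff Q {e}"
  obtain a b c d where eq: "e = {a, b}" "e' = {c, d}"
    and lt: "funpow_dist ?p a c < funpow_dist ?p a b" "funpow_dist ?p a b < funpow_dist ?p a d"
    using cross unfolding chords_intersect_def by blast
  have H: "?H \<subseteq> edges G" using Q(1) e by blast
  have "b \<notin> orbit (curve_next G ?H) a"
    using noncrossing_separates[OF Q e(1) eq(1), of "{}"] by simp
  from f_rg_toggle_merge[OF H e(1) eq(1) this]
  have f2: "f_rg G ?H = Suc (f_rg G Q)"
  proof -
    have "sym_diff ?H {e} = Q" by auto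
    then show ?thesis using \<open>f_rg G ?H = Suc (f_rg G (sym_diff ?H {e}))\<close> by metis
  qed
  have ne: "c \<noteq> a" "d \<noteq> a" using edges_disjoint[OF e] eq by auto
  have \<Omega>: "a \<in> \<Omega>" "c \<in> \<Omega>" "d \<in> \<Omega>" using edge_subset e eq by blast+
  have orb: "c \<in> orbit ?p a" "d \<in> orbit ?p a"
    using f_rg_1_imp_single_curve[OF Q] \<Omega> by blast+
  have "c \<in> arc ?p a b" "d \<notin> arc ?p a b"
    using mem_arc_iff[OF orb(1) ne(1)] mem_arc_iff[OF orb(2) ne(2)] lt by auto
  then have "d \<notin> orbit (curve_next G ?H) c"
    using orbit_subset_arc[OF Q e(1) eq(1), of "{}" c] by auto
  from f_rg_toggle_merge[OF H e(2) eq(2) this]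
  have "f_rg G (sym_diff ?H {e'}) = 1" using f2 Q(2) by simp
  moreover have "sym_diff ?H {e'} = sym_diff Q {e, e'}" using e(3) by auto
  ultimately show ?thesis by metis
qed

section \<open>Existence of quasi-trees\<close>

text \<open>A single curve passes all half-edges and so joins all vertices. If there are no
  half-edges, the one face belongs to the one isolated vertex.\<close>

lemma f_rg_1_imp_k_rg_1:
  assumes Q: "Q \<subseteq> edges G" "f_rg G Q = 1"
  shows "k_rg G Q = 1"
proof -
  have sum1: "num_curves Q + nisolated G = 1" using f_rg_eq[OF Q(1)] Q(2) by simp
  have "\<exists>v. (\<lambda>u. conn Q `` {u}) ` verts G = {v}"
  proof (cases "\<Omega> = {}")
    case True
    then have "num_curves Q = 0" by (simp add: num_curves_def num_orbits_def)
    then have "verts G = {Inr 0}" using sum1 True by (auto simp: verts_def)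
    then show ?thesis by simp
  next
    case False
    then obtain x where x: "x \<in> \<Omega>" by blast
    have "num_curves Q > 0"
      using False unfolding num_curves_def num_orbits_def by (simp add: card_gt_0_iff)
    then have "nisolated G = 0" using sum1 by simp
    then have v: "verts G = vert ` \<Omega>" by (simp add: verts_def)
    have "conn Q `` {vert y} = conn Q `` {vert x}" if "y \<in> \<Omega>" for y
      using curve_conn[OF Q(1) f_rg_1_imp_single_curve[OF Q that x]]
      by (simp only: mconn_class_eq_iff)
    then have "(\<lambda>u. conn Q `` {u}) ` verts G = {conn Q `` {vert x}}"
      unfolding v image_image using x by (metis (no_types, lifting) image_cong image_constant)
    then show ?thesis by blast
  qed
  then show ?thesis by (auto simp: k_rg_def mk_eq)
qed

lemma quasi_trees_eq: "quasi_trees G = {Q. Q \<subseteq> edges G \<and> f_rg G Q = 1}"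
  unfolding quasi_trees_def using f_rg_1_imp_k_rg_1 by blast

lemma connected_imp_conn:
  assumes "connected_rg G" "u \<in> verts G" "v \<in> verts G"
  shows "(u, v) \<in> conn (edges G)"
proof -
  obtain P where "(\<lambda>u. conn (edges G) `` {u}) ` verts G = {P}"
    using assms(1) unfolding connected_rg_def k_rg_def mk_eq
    by (metis card_1_singleton_iff underlying_simps(1) One_nat_def)
  then have "conn (edges G) `` {u} = conn (edges G) `` {v}"
    using assms(2,3) by (metis (no_types, lifting) imageI singletonD)
  then show ?thesis by (simp only: mconn_class_eq_iff)
qed

text \<open>
  A union of boundary curves that contains with each half-edge the opposite one is closed under
  \<open>sigma0\<close> and \<open>sigma1\<close>, hence is everything. So as long as there are two curves, some edge
  meets both of them, and toggling that edge merges them.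
\<close>

lemma single_curve_if_no_merge:
  assumes conn: "connected_rg G" and H: "H \<subseteq> edges G"
    and no_merge: "\<And>x. x \<in> \<Omega> \<Longrightarrow> sigma1 G x \<in> orbit (curve_next G H) x"
  shows "f_rg G H = 1"
proof (cases "\<Omega> = {}")
  case True
  then have "H = {}" using H by (simp add: edges_eq)
  moreover have "card (verts G) = 1"
    using conn True unfolding connected_rg_def k_rg_def by (simp add: edges_eq mk_empty)
  ultimately show ?thesis using f_rg_empty by simp
next
  case False
  then obtain x where x: "x \<in> \<Omega>" by blast
  let ?q = "curve_next G H" and ?P = "orbit (curve_next G H) x"
  have pq: "permutation ?q" by (rule permutation_curve_next[OF H])
  have p0: "permutation (sigma0 G)"
    using sigma0_permutes permutation_permutes finite_half_edges by blast
  have P_sub: "?P \<subseteq> \<Omega>" by (rule permutes_orbit_subset[OF curve_next_permutes[OF H] x])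
  have s1: "sigma1 G y \<in> ?P" if "y \<in> ?P" for y
    using no_merge[of y] that P_sub orbit_trans by (metis subsetD)
  \<comment> \<open>If \<open>y\<close> belongs to \<open>H\<close>, the curve reaches
    \<open>sigma0 G y\<close> from the opposite half-edge; otherwise it does so directly from
    \<open>y\<close>.\<close>
  have s0: "sigma0 G y \<in> ?P" if "y \<in> ?P" for y
  proof (cases "y \<in> \<Union>H")
    case True
    then have "?q (sigma1 G y) = sigma0 G y"
      using sigma1_mem_Union[OF H] by (simp only: curve_next_def sigma1_involution if_True)
    then show ?thesis using orbit.step[OF s1[OF that]] by metis
  next
    case False
    then show ?thesis using orbit.step[OF that] curve_next_outside by metis
  qed
  have o0: "z \<in> ?P" if "y \<in> ?P" "vert z = vert y" for y z
  proof -
    have "z \<in> orbit (sigma0 G) y" using that(2) orbit_eq_iff[OF p0] by blast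
    then show ?thesis by induction (use s0 that(1) in auto)
  qed
  have reach: "\<exists>y\<in>?P. v = vert y" if "(vert x, v) \<in> conn (edges G)" for v
    using that unfolding mconn_def
  proof (induction rule: rtrancl_induct)
    case base
    show ?case using permutation_self_in_orbit[OF pq] by blast
  next
    case (step v w)
    then obtain y e where y: "y \<in> ?P" "v = vert y" and e: "e \<in> edges G" "v \<in> ends G e" "w \<in> ends G e"
      unfolding madj_def by auto
    then obtain j j' where j: "j \<in> e" "vert j = vert y" "j' \<in> e" "w = vert j'"
      unfolding ends_def by auto
    have "j \<in> ?P" using o0 y(1) j(2) by blast
    moreover have "j' = j \<or> j' = sigma1 G j" using edge_eq[OF e(1) j(1)] j(3) by blast
    ultimately have "j' \<in> ?P" using s1 by blast
    then show ?case using j(4) by blast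
  qed
  have x_vert: "vert x \<in> verts G" using x by (simp add: verts_def)
  \<comment> \<open>An isolated vertex would have to be reached from \<open>vert x\<close>, but only
    vertices carrying half-edges are.\<close>
  have "nisolated G = 0"
  proof (rule ccontr)
    assume "nisolated G \<noteq> 0"
    then have "Inr 0 \<in> verts G" by (simp add: verts_def)
    from reach[OF connected_imp_conn[OF conn x_vert this]] show False by blast
  qed
  moreover have "?P = \<Omega>"
  proof
    show "?P \<subseteq> \<Omega>" by (rule P_sub)
    show "\<Omega> \<subseteq> ?P"
    proof
      fix z assume "z \<in> \<Omega>"
      then have "vert z \<in> verts G" by (simp add: verts_def)
      from reach[OF connected_imp_conn[OF conn x_vert this]] show "z \<in> ?P" using o0 by blast
    qed
  qed
  then have "orbit ?q ` \<Omega> = {?P}"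
    using x orbit_eqI_permutation[OF pq] by (metis (no_types, lifting) image_cong image_constant)
  then have "num_curves H = 1" by (simp add: num_curves_def num_orbits_def)
  ultimately show ?thesis using f_rg_eq[OF H] by simp
qed

text \<open>In a subgraph with the fewest faces no edge meets two curves, since toggling it would
  merge them.\<close>

lemma quasi_tree_exists:
  assumes "connected_rg G"
  shows "quasi_trees G \<noteq> {}"
proof -
  obtain H where H: "H \<subseteq> edges G" and min: "\<And>H'. H' \<subseteq> edges G \<Longrightarrow> f_rg G H \<le> f_rg G H'"
    using ex_has_least_nat[of "\<lambda>H. H \<subseteq> edges G" "{}" "f_rg G"] by blast
  have "sigma1 G x \<in> orbit (curve_next G H) x" if x: "x \<in> \<Omega>" for x
  proof (rule ccontr)
    assume "sigma1 G x \<notin> orbit (curve_next G H) x"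
    moreover have e: "{x, sigma1 G x} \<in> edges G" using x by (simp add: edges_eq)
    ultimately have "f_rg G H = Suc (f_rg G (sym_diff H {{x, sigma1 G x}}))"
      using f_rg_toggle_merge[OF H] by blast
    moreover have "sym_diff H {{x, sigma1 G x}} \<subseteq> edges G" using H e by blast
    ultimately show False using min[of "sym_diff H {{x, sigma1 G x}}"] by linarith
  qed
  then have "f_rg G H = 1" by (rule single_curve_if_no_merge[OF assms H])
  then show ?thesis using H unfolding quasi_trees_eq by blast
qed

end

section \<open>Partition of the subsets by activities\<close>

lemma finite_has_max_image:
  fixes f :: "'a \<Rightarrow> 'b::linorder"
  assumes "finite A" "A \<noteq> {}"
  shows "\<exists>a\<in>A. \<forall>x\<in>A. f x \<le> f a"
  using obtains_MAX[OF assms, of f] assms(1) by (metis Max_ge finite_imageI imageI)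

text \<open>
  Walk down from the largest element, following \<open>H\<close> unless the choices made so far force the next
  one: this reaches the unique member of \<open>F\<close> that agrees with \<open>H\<close> off its forced elements.
\<close>

lemma activity_partition:
  fixes \<rho> :: "'e \<Rightarrow> nat"
  assumes E: "finite E" and \<rho>: "inj_on \<rho> E" and F: "F \<subseteq> Pow E" "F \<noteq> {}"
    and forced: "\<And>Q e. Q \<in> F \<Longrightarrow> e \<in> E \<Longrightarrow> e \<in> L Q \<longleftrightarrow>
      (\<forall>Q'\<in>F. (\<forall>x\<in>E. \<rho> e < \<rho> x \<longrightarrow> (x \<in> Q' \<longleftrightarrow> x \<in> Q)) \<longrightarrow> (e \<in> Q' \<longleftrightarrow> e \<in> Q))"
  shows "\<exists>!Q. Q \<in> F \<and> (\<forall>e\<in>E - L Q. e \<in> H \<longleftrightarrow> e \<in> Q)"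
proof (rule ex_ex1I)
  define B where "B Q = {e \<in> E - L Q. (e \<in> H) \<noteq> (e \<in> Q)}" for Q
  \<comment> \<open>\<open>m Q\<close> consists of everything up to the highest non-forced
    disagreement with \<open>H\<close>; minimizing its size pushes that disagreement as low as
    possible.\<close>
  define m where "m Q = {x \<in> E. \<exists>e\<in>B Q. \<rho> x \<le> \<rho> e}" for Q
  obtain Q where Q: "Q \<in> F" and min: "\<And>Q'. Q' \<in> F \<Longrightarrow> card (m Q) \<le> card (m Q')"
    using ex_has_least_nat[of "\<lambda>Q. Q \<in> F" _ "\<lambda>Q. card (m Q)"] F(2) by blast
  have "B Q = {}"
  proof (rule ccontr)
    assume "B Q \<noteq> {}"
    moreover have fB: "finite (B Q)" using E by (simp add: B_def)
    ultimately have "\<exists>e\<in>B Q. \<forall>x\<in>B Q. \<rho> x \<le> \<rho> e" by (intro finite_has_max_image)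
    then obtain e where e: "e \<in> B Q" and max: "\<And>x. x \<in> B Q \<Longrightarrow> \<rho> x \<le> \<rho> e" by blast
    have eE: "e \<in> E" "e \<notin> L Q" using e by (auto simp: B_def)
    obtain Q' where Q': "Q' \<in> F" "(e \<in> Q') \<noteq> (e \<in> Q)"
      and agree: "\<And>x. x \<in> E \<Longrightarrow> \<rho> e < \<rho> x \<Longrightarrow> x \<in> Q' \<longleftrightarrow> x \<in> Q"
      using contrapos_nn[OF eE(2) iffD2[OF forced[OF Q eE(1)]]] by blast
    \<comment> \<open>Whether \<open>x\<close> is forced depends only on the choices above
      \<open>x\<close>. So a disagreement of \<open>Q'\<close> above \<open>e\<close> would also be
      one of \<open>Q\<close>, against the maximality of \<open>e\<close>.\<close>
    have lower: "\<rho> x < \<rho> e" if x: "x \<in> B Q'" for x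
    proof (rule ccontr)
      assume "\<not> \<rho> x < \<rho> e"
      then consider "\<rho> x = \<rho> e" | "\<rho> e < \<rho> x" by linarith
      then show False
      proof cases
        case 1
        then have "x = e" using inj_onD[OF \<rho>] x eE by (auto simp: B_def)
        then show False using x e Q'(2) by (auto simp: B_def)
      next
        case 2
        have xE: "x \<in> E" using x by (simp add: B_def)
        have "(\<forall>y\<in>E. \<rho> x < \<rho> y \<longrightarrow> (y \<in> P \<longleftrightarrow> y \<in> Q')) \<longleftrightarrow>
            (\<forall>y\<in>E. \<rho> x < \<rho> y \<longrightarrow> (y \<in> P \<longleftrightarrow> y \<in> Q))" for P
          using agree 2 by (meson less_trans)
        then have "x \<in> L Q' \<longleftrightarrow> x \<in> L Q"
          using forced[OF Q xE] forced[OF Q'(1) xE] agree[OF xE 2] by simp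
        then have "x \<in> B Q" using x agree[OF xE 2] by (simp add: B_def)
        then show False using max[of x] 2 by simp
      qed
    qed
    have "m Q' \<subset> m Q"
    proof
      show "m Q' \<subseteq> m Q" unfolding m_def using e by (auto dest!: lower intro!: bexI[of _ e])
      have "e \<in> m Q" unfolding m_def using e eE by blast
      moreover have "e \<notin> m Q'" unfolding m_def by (auto dest!: lower)
      ultimately show "m Q' \<noteq> m Q" by blast
    qed
    then have "card (m Q') < card (m Q)"
      using E by (intro psubset_card_mono) (auto simp: m_def)
    then show False using min[OF Q'(1)] by simp
  qed
  then show "\<exists>Q. Q \<in> F \<and> (\<forall>e\<in>E - L Q. e \<in> H \<longleftrightarrow> e \<in> Q)"
    using Q unfolding B_def by blast
next
  fix Q Q'
  assume Q: "Q \<in> F \<and> (\<forall>e\<in>E - L Q. e \<in> H \<longleftrightarrow> e \<in> Q)"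
    and Q': "Q' \<in> F \<and> (\<forall>e\<in>E - L Q'. e \<in> H \<longleftrightarrow> e \<in> Q')"
  show "Q = Q'"
  proof (rule ccontr)
    let ?D = "sym_diff Q Q'"
    assume "Q \<noteq> Q'"
    then have "?D \<noteq> {}" by blast
    moreover have sub: "?D \<subseteq> E" using Q Q' F(1) by blast
    moreover from this have "finite ?D" using E finite_subset by blast
    ultimately have "\<exists>e\<in>?D. \<forall>x\<in>?D. \<rho> x \<le> \<rho> e" by (intro finite_has_max_image)
    then obtain e where e: "e \<in> ?D" and max: "\<And>x. x \<in> ?D \<Longrightarrow> \<rho> x \<le> \<rho> e" by blast
    \<comment> \<open>At the highest difference \<open>e\<close> neither member is forced, since
      each is a witness against the other; then both would have to agree with \<open>H\<close> at
      \<open>e\<close>.\<close>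
    have agree: "\<forall>x\<in>E. \<rho> e < \<rho> x \<longrightarrow> (x \<in> Q' \<longleftrightarrow> x \<in> Q)"
      using max by (meson DiffI UnI1 UnI2 linorder_not_less)
    have "e \<in> E" using e sub by blast
    have "e \<notin> L Q" "e \<notin> L Q'"
      using forced[of Q e] forced[of Q' e] Q Q' \<open>e \<in> E\<close> agree e by blast+
    then show False using Q Q' \<open>e \<in> E\<close> e by blast
  qed
qed

section \<open>The quasi-tree expansion\<close>

locale ordered_ribbon = ribbon +
  fixes r :: "nat set rel"
  assumes order: "linear_order_on (edges G) r"
begin

text \<open>Replaces the relation \<open>r\<close> by an injective numbering, the form needed by the
  induction over chords and by \<open>activity_partition\<close>.\<close>

definition rank :: "nat set \<Rightarrow> nat" where
  "rank e = card {x \<in> edges G. (x, e) \<in> r}"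

lemma rank_less:
  assumes e: "e \<in> edges G" "e' \<in> edges G" and le: "(e', e) \<in> r" "e' \<noteq> e"
  shows "rank e' < rank e"
proof -
  have r: "trans r" "antisym r" "refl_on (edges G) r"
    using order unfolding linear_order_on_def partial_order_on_def preorder_on_def by blast+
  have "{x \<in> edges G. (x, e') \<in> r} \<subseteq> {x \<in> edges G. (x, e) \<in> r}"
    using transD[OF r(1) _ le(1)] by blast
  moreover have "e \<in> {x \<in> edges G. (x, e) \<in> r}" using refl_onD[OF r(3)] e by blast
  moreover have "e \<notin> {x \<in> edges G. (x, e') \<in> r}" using antisymD[OF r(2)] le by blast
  ultimately have "{x \<in> edges G. (x, e') \<in> r} \<subset> {x \<in> edges G. (x, e) \<in> r}" by blast
  then show ?thesis unfolding rank_def by (intro psubset_card_mono) auto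
qed

lemma rank_less_iff:
  assumes e: "e \<in> edges G" "e' \<in> edges G"
  shows "rank e' < rank e \<longleftrightarrow> (e', e) \<in> r \<and> e' \<noteq> e"
proof -
  have "total_on (edges G) r" using order by (simp add: linear_order_on_def)
  then have "e = e' \<or> (e', e) \<in> r \<or> (e, e') \<in> r" using e by (auto simp: total_on_def)
  then show ?thesis using rank_less[OF e] rank_less[OF e(2,1)] by (metis less_asym less_irrefl)
qed

lemma inj_rank: "inj_on rank (edges G)"
proof (rule inj_onI, rule ccontr)
  fix e e' assume e: "e \<in> edges G" "e' \<in> edges G" and eq: "rank e = rank e'" "e \<noteq> e'"
  have "total_on (edges G) r" using order by (simp add: linear_order_on_def)
  then have "(e', e) \<in> r \<or> (e, e') \<in> r" using e eq(2) by (auto simp: total_on_def)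
  then show False using rank_less[OF e] rank_less[OF e(2,1)] eq by force
qed

lemma live_iff:
  assumes "e \<in> edges G"
  shows "live G r Q e \<longleftrightarrow>
    (\<forall>e'\<in>edges G. rank e' < rank e \<longrightarrow> \<not> chords_intersect (curve_next G Q) e e')"
  unfolding live_def using rank_less_iff[OF assms] by blast

text \<open>For a live \<open>e\<close>, toggling \<open>e\<close> together with lower chords
  separates its half-edges, so no quasi-tree results. For a dead \<open>e\<close>, toggling it with
  a lower crossing chord yields a quasi-tree that differs at \<open>e\<close>.\<close>

lemma live_iff_forced:
  assumes Q: "Q \<in> quasi_trees G" and e: "e \<in> edges G"
  shows "live G r Q e \<longleftrightarrow>
    (\<forall>Q'\<in>quasi_trees G. (\<forall>x\<in>edges G. rank e < rank x \<longrightarrow> (x \<in> Q' \<longleftrightarrow> x \<in> Q)) \<longrightarrow> (e \<in> Q' \<longleftrightarrow> e \<in> Q))"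
proof (rule iffI, intro ballI impI)
  have Q_sub: "Q \<subseteq> edges G" "f_rg G Q = 1" using Q by (simp_all add: quasi_trees_eq)
  obtain a b where ab: "e = {a, b}" using edge_obtain[OF e] by metis
  {
    fix Q'
    assume live: "live G r Q e" and "Q' \<in> quasi_trees G"
      and agree: "\<forall>x\<in>edges G. rank e < rank x \<longrightarrow> (x \<in> Q' \<longleftrightarrow> x \<in> Q)"
    then have Q': "Q' \<subseteq> edges G" "f_rg G Q' = 1" by (simp_all add: quasi_trees_eq)
    show "e \<in> Q' \<longleftrightarrow> e \<in> Q"
    proof (rule ccontr)
      assume differ: "\<not> (e \<in> Q' \<longleftrightarrow> e \<in> Q)"
      \<comment> \<open>The remaining differences all rank below \<open>e\<close>, so a live
        \<open>e\<close> crosses none of them.\<close>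
      let ?A = "sym_diff Q Q' - {e}"
      have A: "?A \<subseteq> edges G" using Q_sub(1) Q'(1) by blast
      have "\<not> chords_intersect (curve_next G Q) e e'" if "e' \<in> ?A" for e'
      proof -
        have "e' \<in> edges G" using that A by blast
        moreover from this have "\<not> rank e < rank e'" using agree that by blast
        moreover have "rank e \<noteq> rank e'" using inj_onD[OF inj_rank, of e e'] e that A by blast
        ultimately show ?thesis using live live_iff[OF e] by auto
      qed
      then have "b \<notin> orbit (curve_next G (sym_diff Q (insert e ?A))) a"
        using A by (intro noncrossing_separates[OF Q_sub e ab]) auto
      moreover have "sym_diff Q (insert e ?A) = Q'" using differ by blast
      ultimately have "b \<notin> orbit (curve_next G Q') a" by metis
      then show False using f_rg_1_imp_single_curve[OF Q'] edge_pair_neq e ab by blast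
    qed
  }
  assume forced: "\<forall>Q'\<in>quasi_trees G.
    (\<forall>x\<in>edges G. rank e < rank x \<longrightarrow> (x \<in> Q' \<longleftrightarrow> x \<in> Q)) \<longrightarrow> (e \<in> Q' \<longleftrightarrow> e \<in> Q)"
  show "live G r Q e"
  proof (rule ccontr)
    assume "\<not> live G r Q e"
    then obtain e' where e': "e' \<in> edges G" "rank e' < rank e"
      and cross: "chords_intersect (curve_next G Q) e e'"
      unfolding live_iff[OF e] by blast
    let ?Q' = "sym_diff Q {e, e'}"
    have "e \<noteq> e'" using e'(2) by blast
    from f_rg_crossing[OF Q_sub e e'(1) this cross] have "?Q' \<in> quasi_trees G"
      using Q_sub(1) e e'(1) unfolding quasi_trees_eq by blast
    moreover have "\<forall>x\<in>edges G. rank e < rank x \<longrightarrow> (x \<in> ?Q' \<longleftrightarrow> x \<in> Q)"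
      using e'(2) by auto
    ultimately have "e \<in> ?Q' \<longleftrightarrow> e \<in> Q" using forced by blast
    then show False by blast
  qed
qed

abbreviation "dead \<equiv> internally_dead G r"
abbreviation "int_live \<equiv> internally_live G r"
abbreviation "ext_live \<equiv> externally_live G r"

lemma activity_classes:
  assumes "Q \<in> quasi_trees G"
  shows "Q = dead Q \<union> int_live Q" "dead Q \<inter> int_live Q = {}" "Q \<inter> ext_live Q = {}"
    "Q \<subseteq> edges G" "dead Q \<subseteq> edges G" "int_live Q \<subseteq> edges G" "ext_live Q \<subseteq> edges G" "f_rg G Q = 1"
  using assms unfolding quasi_trees_eq internally_dead_def internally_live_def externally_live_def
  by auto

section \<open>Invariants of the subgraphs belonging to one quasi-tree\<close>

context
  fixes Q S T
  assumes Q: "Q \<in> quasi_trees G" and S: "S \<subseteq> int_live Q" and T: "T \<subseteq> ext_live Q"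
begin

lemma finite_parts: "finite S" "finite T" "finite (dead Q)" "finite (int_live Q)"
  using S T activity_classes[OF Q] finite_subset[OF _ finite_edges] by (meson subset_trans)+

text \<open>The subgraph arises from \<open>Q\<close> by toggling \<open>int_live Q - S\<close> and
  \<open>T\<close>. All these edges are live, so none crosses a lower one and each adds a
  face.\<close>

lemma f_rg_expand: "f_rg G (dead Q \<union> S \<union> T) + card S = Suc (card (int_live Q) + card T)"
proof -
  note ac = activity_classes[OF Q]
  let ?A = "(int_live Q - S) \<union> T"
  have "f_rg G (sym_diff Q ?A) = Suc (card ?A)"
  proof (rule f_rg_noncrossing[OF ac(4,8) _ inj_rank])
    show A: "?A \<subseteq> edges G" using ac T by blast
    fix e e' assume e: "e \<in> ?A" "e' \<in> ?A" "rank e' < rank e"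
    have "live G r Q e" using e(1) T by (auto simp: internally_live_def externally_live_def)
    then show "\<not> chords_intersect (curve_next G Q) e e'"
      using e A live_iff by blast
  qed
  moreover have "sym_diff Q ?A = dead Q \<union> S \<union> T" using ac(1-3) S T by blast
  moreover have "card ?A = card (int_live Q - S) + card T"
    using finite_parts ac(1,3) T by (intro card_Un_disjoint) auto
  moreover have "card (int_live Q - S) + card S = card (int_live Q)"
    using card_Diff_subset[OF finite_parts(1) S] card_mono[OF finite_parts(4) S] by simp
  ultimately show ?thesis by simp
qed

end

text \<open>Each edge of \<open>T\<close> raises the number of faces, whereas an edge joining two
  components would lower it.\<close>

lemma k_rg_expand:
  assumes Q: "Q \<in> quasi_trees G" and S: "S \<subseteq> int_live Q" and T: "T \<subseteq> ext_live Q"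
  shows "k_rg G (dead Q \<union> S \<union> T) = k_rg G (dead Q \<union> S)"
  using finite_parts(2)[OF assms] T
proof (induction T rule: finite_induct)
  case empty
  show ?case by simp
next
  case (insert e T)
  note ac = activity_classes[OF Q]
  let ?H = "dead Q \<union> S \<union> T"
  have T: "T \<subseteq> ext_live Q" and e: "e \<in> ext_live Q" using insert.prems by auto
  have "e \<notin> ?H" using ac(1,3) e S insert.hyps(2) by blast
  moreover have "?H \<subseteq> edges G" using ac S T by blast
  moreover have "e \<in> edges G" using e ac by blast
  moreover have "f_rg G (insert e ?H) = Suc (f_rg G ?H)"
    using f_rg_expand[OF Q S T] f_rg_expand[OF Q S insert.prems] insert.hyps by simp
  ultimately have "k_rg G (insert e ?H) = k_rg G ?H"
    using f_rg_insert_bridge[of ?H e] by (cases "k_rg G (insert e ?H) = k_rg G ?H") simp_all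
  then show ?case using insert.IH[OF T] by simp
qed

lemma quotient_graph_simps:
  "mverts (quotient_graph G r Q) = mcomponents (underlying G) (dead Q)"
  "medges (quotient_graph G r Q) = int_live Q"
  "mends (quotient_graph G r Q) e = {c \<in> mcomponents (underlying G) (dead Q). c \<inter> ends G e \<noteq> {}}"
  by (simp_all add: quotient_graph_def Let_def)

lemma k_rg_quotient:
  assumes Q: "Q \<in> quasi_trees G" and S: "S \<subseteq> int_live Q"
  shows "mk (quotient_graph G r Q) S = k_rg G (dead Q \<union> S)"
  unfolding k_rg_def
proof (rule mk_contract)
  note ac = activity_classes[OF Q]
  fix e assume "e \<in> dead Q \<union> S"
  then have "e \<in> edges G" using ac S by blast
  then show "mends (underlying G) e \<subseteq> mverts (underlying G)" using ends_subset by simp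
qed (simp_all add: quotient_graph_simps)

text \<open>Additive form of the nullity, free of truncated subtraction.\<close>

lemma n_rg_add:
  assumes "H \<subseteq> edges G"
  shows "n_rg G H + card (verts G) = card H + k_rg G H"
proof -
  have "card (mverts (underlying G)) \<le> card H + mk (underlying G) H"
    using mk_le_card_plus_mk_Un[of "underlying G" H "{}"] assms edge_ends_pair
      finite_subset[OF assms] by (auto simp: mk_empty)
  then show ?thesis by (simp add: n_rg_def mnullity_def k_rg_def)
qed

text \<open>Additive form of the nullity in the quotient, which has \<open>k_rg G (dead Q)\<close>
  vertices.\<close>

lemma mnullity_quotient:
  assumes Q: "Q \<in> quasi_trees G" and S: "S \<subseteq> int_live Q"
  shows "mnullity (quotient_graph G r Q) S + k_rg G (dead Q) = card S + k_rg G (dead Q \<union> S)"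
proof -
  have "card (mverts (quotient_graph G r Q)) = k_rg G (dead Q)"
    by (simp add: quotient_graph_simps k_rg_def mk_def)
  moreover have "S \<subseteq> edges G" using activity_classes[OF Q] S by blast
  then have "k_rg G (dead Q) \<le> card S + k_rg G (dead Q \<union> S)"
    unfolding k_rg_def using edge_ends_pair finite_subset[OF _ finite_edges]
    by (intro mk_le_card_plus_mk_Un) auto
  ultimately show ?thesis by (simp add: mnullity_def k_rg_quotient[OF assms])
qed

lemma n_rg_expand:
  assumes Q: "Q \<in> quasi_trees G" and S: "S \<subseteq> int_live Q" and T: "T \<subseteq> ext_live Q"
  shows "n_rg G (dead Q \<union> S \<union> T) = n_rg G (dead Q) + mnullity (quotient_graph G r Q) S + card T"
proof -
  note ac = activity_classes[OF Q]
  have H: "dead Q \<union> S \<union> T \<subseteq> edges G" using ac S T by blast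
  have "card (dead Q \<union> S \<union> T) = card (dead Q \<union> S) + card T"
    using finite_parts[OF assms] ac(1,3) S T by (intro card_Un_disjoint) auto
  also have "card (dead Q \<union> S) = card (dead Q) + card S"
    using finite_parts[OF assms] ac(2) S by (intro card_Un_disjoint) auto
  finally show ?thesis
    using n_rg_add[OF H] n_rg_add[OF ac(5)] k_rg_expand[OF assms] mnullity_quotient[OF Q S]
    by linarith
qed

text \<open>Adding \<open>S\<close> removes \<open>card S\<close> faces and adding \<open>T\<close>
  restores \<open>card T\<close>, which cancels the share of \<open>T\<close> in the nullity. So
  \<open>k + n - f\<close> grows by twice the nullity of \<open>S\<close> in the quotient.\<close>

lemma g_rg_expand:
  assumes Q: "Q \<in> quasi_trees G" and S: "S \<subseteq> int_live Q" and T: "T \<subseteq> ext_live Q"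
  shows "g_rg G (dead Q \<union> S \<union> T) = g_rg G (dead Q) + mnullity (quotient_graph G r Q) S"
proof -
  note ac = activity_classes[OF Q]
  let ?H = "dead Q \<union> S \<union> T" and ?n = "mnullity (quotient_graph G r Q) S"
  have fD: "f_rg G (dead Q) = Suc (card (int_live Q))" using f_rg_expand[OF Q, of "{}" "{}"] by simp
  \<comment> \<open>Euler's inequality for \<open>dead Q\<close> keeps the natural-number
    differences below from truncating.\<close>
  have "f_rg G (dead Q) \<le> k_rg G (dead Q) + n_rg G (dead Q)"
    using euler_inequality[OF ac(5)] n_rg_add[OF ac(5)] by linarith
  then have "k_rg G ?H + n_rg G ?H - f_rg G ?H =
      (k_rg G (dead Q) + n_rg G (dead Q) - f_rg G (dead Q)) + 2 * ?n"
    using fD f_rg_expand[OF assms] k_rg_expand[OF assms] n_rg_expand[OF assms]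
      mnullity_quotient[OF Q S] by linarith
  then show ?thesis by (simp add: g_rg_def)
qed

text \<open>Live edges are free and all others are fixed as in \<open>Q\<close>, so a subgraph is
  recovered from its two live parts.\<close>

lemma activity_interval:
  assumes Q: "Q \<in> quasi_trees G"
  shows "bij_betw (\<lambda>(S, T). dead Q \<union> S \<union> T) (Pow (int_live Q) \<times> Pow (ext_live Q))
    {H \<in> Pow (edges G). \<forall>e\<in>edges G - {e. live G r Q e}. e \<in> H \<longleftrightarrow> e \<in> Q}"
proof (rule bij_betw_byWitness[where f' = "\<lambda>H. (H \<inter> int_live Q, H \<inter> ext_live Q)"])
  have sub: "Q \<subseteq> edges G" by (rule activity_classes(4)[OF Q])
  note defs = internally_dead_def internally_live_def externally_live_def
  show "\<forall>a\<in>Pow (int_live Q) \<times> Pow (ext_live Q).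
      (\<lambda>H. (H \<inter> int_live Q, H \<inter> ext_live Q)) ((\<lambda>(S, T). dead Q \<union> S \<union> T) a) = a"
    unfolding defs by auto
  show "\<forall>H\<in>{H \<in> Pow (edges G). \<forall>e\<in>edges G - {e. live G r Q e}. e \<in> H \<longleftrightarrow> e \<in> Q}.
      (\<lambda>(S, T). dead Q \<union> S \<union> T) (H \<inter> int_live Q, H \<inter> ext_live Q) = H"
    using sub unfolding defs by auto
  show "(\<lambda>(S, T). dead Q \<union> S \<union> T) ` (Pow (int_live Q) \<times> Pow (ext_live Q)) \<subseteq>
      {H \<in> Pow (edges G). \<forall>e\<in>edges G - {e. live G r Q e}. e \<in> H \<longleftrightarrow> e \<in> Q}"
    using sub unfolding defs by auto
  show "(\<lambda>H. (H \<inter> int_live Q, H \<inter> ext_live Q)) `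
      {H \<in> Pow (edges G). \<forall>e\<in>edges G - {e. live G r Q e}. e \<in> H \<longleftrightarrow> e \<in> Q} \<subseteq>
      Pow (int_live Q) \<times> Pow (ext_live Q)"
    by auto
qed

text \<open>Subgraphs are grouped by the unique quasi-tree agreeing with them off its live
  edges.\<close>

lemma sum_Pow_edges:
  fixes w :: "nat set set \<Rightarrow> 'a::comm_monoid_add"
  assumes "connected_rg G"
  shows "(\<Sum>H\<in>Pow (edges G). w H) =
    (\<Sum>Q\<in>quasi_trees G. \<Sum>S\<in>Pow (int_live Q). \<Sum>T\<in>Pow (ext_live Q). w (dead Q \<union> S \<union> T))"
proof -
  let ?in = "\<lambda>H Q. \<forall>e\<in>edges G - {e. live G r Q e}. e \<in> H \<longleftrightarrow> e \<in> Q"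
  define tree where "tree H = (THE Q. Q \<in> quasi_trees G \<and> ?in H Q)" for H
  have ex1: "\<exists>!Q. Q \<in> quasi_trees G \<and> ?in H Q" for H
  proof (rule activity_partition[OF finite_edges inj_rank])
    show "quasi_trees G \<subseteq> Pow (edges G)" by (auto simp: quasi_trees_def)
    show "quasi_trees G \<noteq> {}" by (rule quasi_tree_exists[OF assms])
  qed (simp add: live_iff_forced)
  have tree: "tree H \<in> quasi_trees G" "?in H (tree H)" for H
    using theI'[OF ex1[of H]] unfolding tree_def by blast+
  have tree_iff: "tree H = Q \<longleftrightarrow> ?in H Q" if "Q \<in> quasi_trees G" for H Q
    using ex1[of H] tree[of H] that by metis
  have fin_quasi: "finite (quasi_trees G)"
    by (rule finite_subset[of _ "Pow (edges G)"]) (auto simp: quasi_trees_def)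
  have "(\<Sum>H\<in>Pow (edges G). w H) = (\<Sum>Q\<in>quasi_trees G. \<Sum>H\<in>{H \<in> Pow (edges G). tree H = Q}. w H)"
    using tree(1) by (intro sum.group[symmetric] fin_quasi) auto
  also have "\<dots> = (\<Sum>Q\<in>quasi_trees G. \<Sum>(S, T)\<in>Pow (int_live Q) \<times> Pow (ext_live Q). w (dead Q \<union> S \<union> T))"
  proof (rule sum.cong[OF refl])
    fix Q assume Q: "Q \<in> quasi_trees G"
    have "{H \<in> Pow (edges G). tree H = Q} = {H \<in> Pow (edges G). ?in H Q}"
      using tree_iff[OF Q] by blast
    then show "(\<Sum>H\<in>{H \<in> Pow (edges G). tree H = Q}. w H) =
        (\<Sum>(S, T)\<in>Pow (int_live Q) \<times> Pow (ext_live Q). w (dead Q \<union> S \<union> T))"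
      using sum.reindex_bij_betw[OF activity_interval[OF Q], of w]
      by (simp add: case_prod_unfold)
  qed
  also have "\<dots> = (\<Sum>Q\<in>quasi_trees G. \<Sum>S\<in>Pow (int_live Q). \<Sum>T\<in>Pow (ext_live Q). w (dead Q \<union> S \<union> T))"
    by (simp only: sum.cartesian_product)
  finally show ?thesis .
qed

end

text \<open>The binomial theorem, read off by expanding a product of equal factors over
  subsets.\<close>

lemma sum_Pow_power_card:
  fixes y :: "'a::comm_semiring_1"
  assumes "finite A"
  shows "(\<Sum>T\<in>Pow A. y ^ card T) = (1 + y) ^ card A"
proof -
  have "(\<Prod>x\<in>A. y + 1) = (\<Sum>T\<in>Pow A. (\<Prod>x\<in>T. y) * (\<Prod>x\<in>A - T. 1))"
    by (rule prod_add[OF assms])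
  then show ?thesis by (simp add: add.commute)
qed

theorem theorem1:
  fixes G :: ribbon_graph and r :: "nat set rel"
  assumes "is_ribbon_graph G"
    and "connected_rg G"
    and "linear_order_on (edges G) r"
  shows "brt_poly G =
    (\<Sum>Q\<in>quasi_trees G.
       varY ^ n_rg G (internally_dead G r Q) *
       varZ ^ g_rg G (internally_dead G r Q) *
       (1 + varY) ^ card (externally_live G r Q) *
       tutte (quotient_graph G r Q) varX (1 + varY * varZ))"
proof -
  interpret ordered_ribbon G r using assms(1,3) by unfold_locales
  have k1: "k_rg G (edges G) = 1" using assms(2) by (simp add: connected_rg_def)
  let ?w = "\<lambda>H. (varX - 1) ^ (k_rg G H - 1) * varY ^ n_rg G H * varZ ^ g_rg G H"
  have "brt_poly G = (\<Sum>Q\<in>quasi_trees G. \<Sum>S\<in>Pow (int_live Q). \<Sum>T\<in>Pow (ext_live Q). ?w (dead Q \<union> S \<union> T))"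
    unfolding brt_poly_def k1 by (rule sum_Pow_edges[OF assms(2)])
  also have "\<dots> = (\<Sum>Q\<in>quasi_trees G. varY ^ n_rg G (dead Q) * varZ ^ g_rg G (dead Q) *
       (1 + varY) ^ card (ext_live Q) * tutte (quotient_graph G r Q) varX (1 + varY * varZ))"
  proof (rule sum.cong[OF refl])
    fix Q assume Q: "Q \<in> quasi_trees G"
    let ?M = "quotient_graph G r Q"
    let ?c = "varY ^ n_rg G (dead Q) * varZ ^ g_rg G (dead Q)"
    let ?s = "\<lambda>S. (varX - 1) ^ (mk ?M S - 1) * (varY * varZ) ^ mnullity ?M S"
    \<comment> \<open>The quotient is connected because \<open>dead Q\<close> and
      \<open>int_live Q\<close> make up \<open>Q\<close>. Hence its Tutte polynomial and
      \<open>brt_poly\<close> subtract the same 1 in the exponent.\<close>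
    have "k_rg G Q = 1" using Q by (simp add: quasi_trees_def)
    then have mk1: "mk ?M (int_live Q) = 1"
      using k_rg_quotient[OF Q order.refl] activity_classes(1)[OF Q] by simp
    \<comment> \<open>Nullity and genus grow by the same amount in \<open>S\<close>, which gives
      powers of \<open>varY * varZ\<close>, the value of \<open>y - 1\<close> in
      \<open>tutte\<close>; \<open>T\<close> leaves only \<open>varY ^ card T\<close>.\<close>
    have "?w (dead Q \<union> S \<union> T) = ?c * (varY ^ card T * ?s S)"
      if "S \<in> Pow (int_live Q)" "T \<in> Pow (ext_live Q)" for S T
    proof -
      have ST: "S \<subseteq> int_live Q" "T \<subseteq> ext_live Q" using that by auto
      show ?thesis
        unfolding n_rg_expand[OF Q ST] g_rg_expand[OF Q ST] k_rg_expand[OF Q ST]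
          k_rg_quotient[OF Q ST(1)] power_add power_mult_distrib by (simp only: ac_simps)
    qed
    then have "(\<Sum>S\<in>Pow (int_live Q). \<Sum>T\<in>Pow (ext_live Q). ?w (dead Q \<union> S \<union> T)) =
        (\<Sum>S\<in>Pow (int_live Q). \<Sum>T\<in>Pow (ext_live Q). ?c * (varY ^ card T * ?s S))"
      by (intro sum.cong[OF refl]) blast
    also have "\<dots> = ?c * ((\<Sum>T\<in>Pow (ext_live Q). varY ^ card T) * (\<Sum>S\<in>Pow (int_live Q). ?s S))"
      by (simp only: sum_distrib_left[symmetric] sum_distrib_right[symmetric])
    also have "(\<Sum>T\<in>Pow (ext_live Q). varY ^ card T) = (1 + varY) ^ card (ext_live Q)"
      using finite_subset[OF activity_classes(7)[OF Q]] by (intro sum_Pow_power_card) simp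
    also have "(\<Sum>S\<in>Pow (int_live Q). ?s S) = tutte ?M varX (1 + varY * varZ)"
    proof -
      show ?thesis by (simp add: tutte_def quotient_graph_simps(2) mk1)
    qed
    finally show "(\<Sum>S\<in>Pow (int_live Q). \<Sum>T\<in>Pow (ext_live Q). ?w (dead Q \<union> S \<union> T)) =
        ?c * (1 + varY) ^ card (ext_live Q) * tutte ?M varX (1 + varY * varZ)"
      by (simp only: mult.assoc)
  qed
  finally show ?thesis .
qed

end
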